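(* A regular category $\mathbb{E}$ is a Mal'tsev category if and only if the following holds: for all split epimorphisms with given sections $(f'\colon X'\to Y',\, s'\colon Y'\to X')$ and $(f\colon X\to Y,\, s\colon Y\to X)$ (so $f's'=1_{Y'}$, $fs=1_Y$) and all regular epimorphisms $x\colon X'\to X$ and $y\colon Y'\to Y$ such that $f x=y f'$ and $x s'=s y$, the commutative square $fx=yf'$ is a regular pushout, i.e. the induced factorization $X'\to Y'\times_Y X$ to the pullback of $f$ along $y$ is a regular epimorphism.
   Context: A category is regular if it is finitely complete, regular epimorphisms (coequalizers of some parallel pair) are stable under pullbacks, and every kernel pair has a coequalizer. A Mal'tsev category is a finitely complete category in which every (internal) reflexive relation is an equivalence relation. *)

theory Defs
  imports Main
begin

section \<open>Categories\<close>

record ('o, 'm) category =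
  Obj :: "'o set"
  Arr :: "'m set"
  Dom :: "'m \<Rightarrow> 'o"
  Cod :: "'m \<Rightarrow> 'o"
  Ident :: "'o \<Rightarrow> 'm"
  Comp :: "'m \<Rightarrow> 'm \<Rightarrow> 'm"  (infixr "\<cdot>\<index>" 70)

definition hom :: "('o, 'm, 'z) category_scheme \<Rightarrow> 'o \<Rightarrow> 'o \<Rightarrow> 'm set" where
  "hom C X Y = {f \<in> Arr C. Dom C f = X \<and> Cod C f = Y}"

text \<open>Composition is written in applicative order: \<open>g \<cdot> f\<close> is \<open>g\<close> after \<open>f\<close>. Its value on
  non-composable arguments, and the values of all operations outside the carriers, are irrelevant.\<close>

locale category =
  fixes C :: "('o, 'm, 'z) category_scheme" (structure)
  assumes Dom_Obj: "f \<in> Arr C \<Longrightarrow> Dom C f \<in> Obj C"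
    and Cod_Obj: "f \<in> Arr C \<Longrightarrow> Cod C f \<in> Obj C"
    and Ident_hom: "X \<in> Obj C \<Longrightarrow> Ident C X \<in> hom C X X"
    and Comp_hom: "\<lbrakk>f \<in> hom C X Y; g \<in> hom C Y Z\<rbrakk> \<Longrightarrow> g \<cdot> f \<in> hom C X Z"
    and Comp_Ident: "f \<in> hom C X Y \<Longrightarrow> f \<cdot> Ident C X = f"
    and Ident_Comp: "f \<in> hom C X Y \<Longrightarrow> Ident C Y \<cdot> f = f"
    and Comp_assoc: "\<lbrakk>f \<in> hom C X Y; g \<in> hom C Y Z; h \<in> hom C Z W\<rbrakk>
                       \<Longrightarrow> (h \<cdot> g) \<cdot> f = h \<cdot> (g \<cdot> f)"


section \<open>Finite limits\<close>

definition is_functor ::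
  "('i, 'j, 'y) category_scheme \<Rightarrow> ('o, 'm, 'z) category_scheme \<Rightarrow> ('i \<Rightarrow> 'o) \<Rightarrow> ('j \<Rightarrow> 'm) \<Rightarrow> bool" where
  "is_functor J C Fo Fm \<longleftrightarrow>
     (\<forall>i \<in> Obj J. Fo i \<in> Obj C) \<and>
     (\<forall>u \<in> Arr J. Fm u \<in> hom C (Fo (Dom J u)) (Fo (Cod J u))) \<and>
     (\<forall>i \<in> Obj J. Fm (Ident J i) = Ident C (Fo i)) \<and>
     (\<forall>u \<in> Arr J. \<forall>v \<in> Arr J. Cod J u = Dom J v \<longrightarrow> Fm (v \<cdot>\<^bsub>J\<^esub> u) = Fm v \<cdot>\<^bsub>C\<^esub> Fm u)"

definition is_cone ::
  "('i, 'j, 'y) category_scheme \<Rightarrow> ('o, 'm, 'z) category_scheme \<Rightarrow> ('i \<Rightarrow> 'o) \<Rightarrow> ('j \<Rightarrow> 'm)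
     \<Rightarrow> 'o \<Rightarrow> ('i \<Rightarrow> 'm) \<Rightarrow> bool" where
  "is_cone J C Fo Fm L \<pi> \<longleftrightarrow>
     L \<in> Obj C \<and>
     (\<forall>i \<in> Obj J. \<pi> i \<in> hom C L (Fo i)) \<and>
     (\<forall>u \<in> Arr J. Fm u \<cdot>\<^bsub>C\<^esub> \<pi> (Dom J u) = \<pi> (Cod J u))"

definition is_limit ::
  "('i, 'j, 'y) category_scheme \<Rightarrow> ('o, 'm, 'z) category_scheme \<Rightarrow> ('i \<Rightarrow> 'o) \<Rightarrow> ('j \<Rightarrow> 'm)
     \<Rightarrow> 'o \<Rightarrow> ('i \<Rightarrow> 'm) \<Rightarrow> bool" where
  "is_limit J C Fo Fm L \<pi> \<longleftrightarrow>
     is_cone J C Fo Fm L \<pi> \<and>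
     (\<forall>T \<tau>. is_cone J C Fo Fm T \<tau> \<longrightarrow>
        (\<exists>!h. h \<in> hom C T L \<and> (\<forall>i \<in> Obj J. \<pi> i \<cdot>\<^bsub>C\<^esub> h = \<tau> i)))"

text \<open>Every finite category is isomorphic to one whose objects and arrows are natural numbers, so
  letting the shape \<open>J\<close> range over categories on \<open>nat\<close> covers all finite diagrams.\<close>

definition finitely_complete :: "('o, 'm, 'z) category_scheme \<Rightarrow> bool" where
  "finitely_complete C \<longleftrightarrow>
     (\<forall>(J :: (nat, nat) category) Fo Fm.
        category J \<and> finite (Obj J) \<and> finite (Arr J) \<and> is_functor J C Fo Fm \<longrightarrow>
        (\<exists>L \<pi>. is_limit J C Fo Fm L \<pi>))"


section \<open>Pullbacks, coequalizers and regular categories\<close>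

text \<open>\<open>is_pullback C f g P p q\<close>: the object \<open>P\<close> with \<open>p : P \<rightarrow> Dom f\<close> and \<open>q : P \<rightarrow> Dom g\<close> is a
  pullback of the cospan \<open>f, g\<close>; the arrow \<open>p\<close> is the pullback of \<open>g\<close> along \<open>f\<close>, and \<open>q\<close> that of \<open>f\<close>
  along \<open>g\<close>.\<close>

definition is_pullback ::
  "('o, 'm, 'z) category_scheme \<Rightarrow> 'm \<Rightarrow> 'm \<Rightarrow> 'o \<Rightarrow> 'm \<Rightarrow> 'm \<Rightarrow> bool" where
  "is_pullback C f g P p q \<longleftrightarrow>
     f \<in> Arr C \<and> g \<in> Arr C \<and> Cod C f = Cod C g \<and>
     p \<in> hom C P (Dom C f) \<and> q \<in> hom C P (Dom C g) \<and>
     f \<cdot>\<^bsub>C\<^esub> p = g \<cdot>\<^bsub>C\<^esub> q \<and>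
     (\<forall>T a b. a \<in> hom C T (Dom C f) \<and> b \<in> hom C T (Dom C g) \<and> f \<cdot>\<^bsub>C\<^esub> a = g \<cdot>\<^bsub>C\<^esub> b \<longrightarrow>
        (\<exists>!h. h \<in> hom C T P \<and> p \<cdot>\<^bsub>C\<^esub> h = a \<and> q \<cdot>\<^bsub>C\<^esub> h = b))"

definition is_kernel_pair ::
  "('o, 'm, 'z) category_scheme \<Rightarrow> 'm \<Rightarrow> 'o \<Rightarrow> 'm \<Rightarrow> 'm \<Rightarrow> bool" where
  "is_kernel_pair C f P p q \<longleftrightarrow> is_pullback C f f P p q"

definition is_coequalizer ::
  "('o, 'm, 'z) category_scheme \<Rightarrow> 'm \<Rightarrow> 'm \<Rightarrow> 'm \<Rightarrow> bool" where
  "is_coequalizer C u v e \<longleftrightarrow>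
     u \<in> Arr C \<and> v \<in> Arr C \<and> Dom C u = Dom C v \<and> Cod C u = Cod C v \<and>
     e \<in> Arr C \<and> Dom C e = Cod C u \<and>
     e \<cdot>\<^bsub>C\<^esub> u = e \<cdot>\<^bsub>C\<^esub> v \<and>
     (\<forall>T k. k \<in> hom C (Cod C u) T \<and> k \<cdot>\<^bsub>C\<^esub> u = k \<cdot>\<^bsub>C\<^esub> v \<longrightarrow>
        (\<exists>!h. h \<in> hom C (Cod C e) T \<and> h \<cdot>\<^bsub>C\<^esub> e = k))"

definition regular_epi :: "('o, 'm, 'z) category_scheme \<Rightarrow> 'm \<Rightarrow> bool" where
  "regular_epi C e \<longleftrightarrow> (\<exists>u v. is_coequalizer C u v e)"

definition regular_category :: "('o, 'm, 'z) category_scheme \<Rightarrow> bool" where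
  "regular_category C \<longleftrightarrow>
     category C \<and>
     finitely_complete C \<and>
     (\<forall>f e P p q. is_pullback C f e P p q \<and> regular_epi C e \<longrightarrow> regular_epi C p) \<and>
     (\<forall>f P p q. is_kernel_pair C f P p q \<longrightarrow> (\<exists>e. is_coequalizer C p q e))"


section \<open>Internal relations and Mal'tsev categories\<close>

text \<open>An internal relation on \<open>X\<close> is a span \<open>d0, d1 : R \<rightarrow> X\<close> that is jointly monic, that is, one
  representing a subobject of \<open>X \<times> X\<close>.\<close>

definition internal_relation ::
  "('o, 'm, 'z) category_scheme \<Rightarrow> 'o \<Rightarrow> 'o \<Rightarrow> 'm \<Rightarrow> 'm \<Rightarrow> bool" where
  "internal_relation C X R d0 d1 \<longleftrightarrow>
     d0 \<in> hom C R X \<and> d1 \<in> hom C R X \<and>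
     (\<forall>T u v. u \<in> hom C T R \<and> v \<in> hom C T R \<and>
        d0 \<cdot>\<^bsub>C\<^esub> u = d0 \<cdot>\<^bsub>C\<^esub> v \<and> d1 \<cdot>\<^bsub>C\<^esub> u = d1 \<cdot>\<^bsub>C\<^esub> v \<longrightarrow> u = v)"

definition reflexive_relation ::
  "('o, 'm, 'z) category_scheme \<Rightarrow> 'o \<Rightarrow> 'o \<Rightarrow> 'm \<Rightarrow> 'm \<Rightarrow> bool" where
  "reflexive_relation C X R d0 d1 \<longleftrightarrow>
     internal_relation C X R d0 d1 \<and>
     (\<exists>r. r \<in> hom C X R \<and> d0 \<cdot>\<^bsub>C\<^esub> r = Ident C X \<and> d1 \<cdot>\<^bsub>C\<^esub> r = Ident C X)"

definition symmetric_relation ::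
  "('o, 'm, 'z) category_scheme \<Rightarrow> 'o \<Rightarrow> 'o \<Rightarrow> 'm \<Rightarrow> 'm \<Rightarrow> bool" where
  "symmetric_relation C X R d0 d1 \<longleftrightarrow>
     internal_relation C X R d0 d1 \<and>
     (\<exists>\<sigma>. \<sigma> \<in> hom C R R \<and> d0 \<cdot>\<^bsub>C\<^esub> \<sigma> = d1 \<and> d1 \<cdot>\<^bsub>C\<^esub> \<sigma> = d0)"

text \<open>Pullbacks are unique up to isomorphism, so it is immaterial which pullback is taken;
  the definitions quantify over all of them and are meant for categories in which they exist.\<close>

definition transitive_relation ::
  "('o, 'm, 'z) category_scheme \<Rightarrow> 'o \<Rightarrow> 'o \<Rightarrow> 'm \<Rightarrow> 'm \<Rightarrow> bool" where
  "transitive_relation C X R d0 d1 \<longleftrightarrow>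
     internal_relation C X R d0 d1 \<and>
     (\<forall>P p q. is_pullback C d1 d0 P p q \<longrightarrow>
        (\<exists>t. t \<in> hom C P R \<and> d0 \<cdot>\<^bsub>C\<^esub> t = d0 \<cdot>\<^bsub>C\<^esub> p \<and> d1 \<cdot>\<^bsub>C\<^esub> t = d1 \<cdot>\<^bsub>C\<^esub> q))"

definition equivalence_relation ::
  "('o, 'm, 'z) category_scheme \<Rightarrow> 'o \<Rightarrow> 'o \<Rightarrow> 'm \<Rightarrow> 'm \<Rightarrow> bool" where
  "equivalence_relation C X R d0 d1 \<longleftrightarrow>
     reflexive_relation C X R d0 d1 \<and>
     symmetric_relation C X R d0 d1 \<and>
     transitive_relation C X R d0 d1"

definition maltsev_category :: "('o, 'm, 'z) category_scheme \<Rightarrow> bool" where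
  "maltsev_category C \<longleftrightarrow>
     category C \<and>
     finitely_complete C \<and>
     (\<forall>X R d0 d1. reflexive_relation C X R d0 d1 \<longrightarrow> equivalence_relation C X R d0 d1)"


section \<open>Split epimorphisms and regular pushouts\<close>

definition split_epi_with_section ::
  "('o, 'm, 'z) category_scheme \<Rightarrow> 'o \<Rightarrow> 'o \<Rightarrow> 'm \<Rightarrow> 'm \<Rightarrow> bool" where
  "split_epi_with_section C X Y f s \<longleftrightarrow>
     f \<in> hom C X Y \<and> s \<in> hom C Y X \<and> f \<cdot>\<^bsub>C\<^esub> s = Ident C Y"

text \<open>\<open>regular_pushout C f' x y f\<close> concerns the commutative square \<open>f \<cdot> x = y \<cdot> f'\<close> with
  \<open>f' : X' \<rightarrow> Y'\<close>, \<open>x : X' \<rightarrow> X\<close>, \<open>y : Y' \<rightarrow> Y\<close>, \<open>f : X \<rightarrow> Y\<close>; the arrow \<open>h\<close> is the induced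
  factorization \<open>X' \<rightarrow> Y' \<times>\<^sub>Y X\<close>.\<close>

definition regular_pushout ::
  "('o, 'm, 'z) category_scheme \<Rightarrow> 'm \<Rightarrow> 'm \<Rightarrow> 'm \<Rightarrow> 'm \<Rightarrow> bool" where
  "regular_pushout C f' x y f \<longleftrightarrow>
     f \<cdot>\<^bsub>C\<^esub> x = y \<cdot>\<^bsub>C\<^esub> f' \<and>
     (\<forall>P p q h. is_pullback C y f P p q \<and>
        h \<in> hom C (Dom C x) P \<and> p \<cdot>\<^bsub>C\<^esub> h = f' \<and> q \<cdot>\<^bsub>C\<^esub> h = x \<longrightarrow> regular_epi C h)"

end

theory Submission
  imports Defs
begin

text \<open>Both conditions are equivalent to a third one: every relation \<open>R\<close> between
  two objects is difunctional, that is, \<open>(c, d)\<close>, \<open>(a, d)\<close> and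
  \<open>(a, b)\<close> in \<open>R\<close> force \<open>(c, b)\<close> in \<open>R\<close>. The
  arguments work with generalized elements, arrows out of an arbitrary test object \<open>T\<close>.

  If every reflexive relation is symmetric, this is applied to a reflexive relation on the object
  \<open>R\<close> itself whose symmetry says that \<open>R\<close> is difunctional
  (\<open>maltsev_difunctional\<close>). Conversely, in the presence of reflexivity, symmetry and
  transitivity are instances of difunctionality (\<open>difunctional_maltsev\<close>).

  Given the condition on squares, compare the object \<open>P\<close> of all triples as above with
  the subobject \<open>S\<close> where the conclusion holds. The degenerate triples lie in
  \<open>S\<close> and provide the sections of a square whose comparison map is the inclusion of
  \<open>S\<close> in \<open>P\<close>. It is then both a regular epimorphism and a monomorphism,
  hence invertible (\<open>squares_difunctional\<close>).

  Given difunctionality, the image of the comparison map of a square is a relation between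
  \<open>Y'\<close> and \<open>X\<close>. The sections supply enough pairs in that relation for
  difunctionality to yield every pair of the pullback, after passing to a regular epimorphic cover;
  so the image is the whole pullback (\<open>difunctional_squares\<close>). Regularity of the
  category provides the image (\<open>image_factorization\<close>) and the cover. In both directions
  the conclusion comes from \<open>regular_epi_through_monic\<close>: a monomorphism through which a
  regular epimorphism factors is invertible.\<close>

context category
begin

section \<open>Calculus of arrows and composition\<close>

lemma homD: "f \<in> hom C X Y \<Longrightarrow> f \<in> Arr C \<and> Dom C f = X \<and> Cod C f = Y"
  by (simp add: hom_def)

lemma in_homI [intro]: "\<lbrakk>f \<in> Arr C; Dom C f = X; Cod C f = Y\<rbrakk> \<Longrightarrow> f \<in> hom C X Y"
  by (simp add: hom_def)

lemma comp_simps [simp]: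
  assumes "f \<in> Arr C" "g \<in> Arr C" "Cod C f = Dom C g"
  shows "g \<cdot> f \<in> Arr C" "Dom C (g \<cdot> f) = Dom C f" "Cod C (g \<cdot> f) = Cod C g"
  using Comp_hom[of f "Dom C f" "Cod C f" g "Cod C g"] assms by (auto simp: hom_def)

lemma ident_simps [simp]:
  assumes "X \<in> Obj C"
  shows "Ident C X \<in> Arr C" "Dom C (Ident C X) = X" "Cod C (Ident C X) = X"
  using Ident_hom[OF assms] by (auto simp: hom_def)

lemma comp_ident_simps [simp]:
  "f \<in> Arr C \<Longrightarrow> Dom C f = X \<Longrightarrow> f \<cdot> Ident C X = f"
  "f \<in> Arr C \<Longrightarrow> Cod C f = X \<Longrightarrow> Ident C X \<cdot> f = f"
  using Comp_Ident Ident_Comp by (auto simp: hom_def)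

lemma assoc:
  "\<lbrakk>f \<in> Arr C; g \<in> Arr C; h \<in> Arr C; Cod C f = Dom C g; Cod C g = Dom C h\<rbrakk>
    \<Longrightarrow> (h \<cdot> g) \<cdot> f = h \<cdot> (g \<cdot> f)"
  using Comp_assoc[of f "Dom C f" "Cod C f" g "Cod C g" h "Cod C h"] by (auto simp: hom_def)

lemma obj_simps [simp]: "f \<in> Arr C \<Longrightarrow> Dom C f \<in> Obj C" "f \<in> Arr C \<Longrightarrow> Cod C f \<in> Obj C"
  by (simp_all add: Dom_Obj Cod_Obj)

lemma hom_obj: "f \<in> hom C X Y \<Longrightarrow> X \<in> Obj C \<and> Y \<in> Obj C"
  using Dom_Obj Cod_Obj by (auto simp: hom_def)

text \<open>Composites are kept nested to the right, so an equation between two composites does not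
  rewrite a longer one directly; this lemma and \<open>whisker1\<close> precompose it with
  \<open>z\<close> in the nested form.\<close>

lemma whisker:
  assumes "g \<cdot> f = k \<cdot> l" "z \<in> Arr C" "f \<in> Arr C" "g \<in> Arr C" "k \<in> Arr C" "l \<in> Arr C"
    "Cod C z = Dom C f" "Cod C z = Dom C l" "Cod C f = Dom C g" "Cod C l = Dom C k"
  shows "g \<cdot> (f \<cdot> z) = k \<cdot> (l \<cdot> z)"
  using assms by (metis assoc)

lemma whisker1:
  assumes "g \<cdot> f = k" "z \<in> Arr C" "f \<in> Arr C" "g \<in> Arr C"
    "Cod C z = Dom C f" "Cod C f = Dom C g"
  shows "g \<cdot> (f \<cdot> z) = k \<cdot> z"
  using assms by (metis assoc)

section \<open>Monomorphisms, relations and pullbacks\<close>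

definition monic :: "'m \<Rightarrow> bool" where
  "monic m \<longleftrightarrow> m \<in> Arr C \<and>
     (\<forall>T u v. u \<in> hom C T (Dom C m) \<and> v \<in> hom C T (Dom C m) \<and> m \<cdot> u = m \<cdot> v \<longrightarrow> u = v)"

text \<open>Unlike \<open>internal_relation\<close>, the two legs may have different codomains. This
  generality is needed for the image of a comparison map, a relation between \<open>Y'\<close> and
  \<open>X\<close>.\<close>

definition jointly_monic :: "'o \<Rightarrow> 'm \<Rightarrow> 'm \<Rightarrow> bool" where
  "jointly_monic R d0 d1 \<longleftrightarrow>
     d0 \<in> Arr C \<and> d1 \<in> Arr C \<and> Dom C d0 = R \<and> Dom C d1 = R \<and>
     (\<forall>T u v. u \<in> hom C T R \<and> v \<in> hom C T R \<and> d0 \<cdot> u = d0 \<cdot> v \<and> d1 \<cdot> u = d1 \<cdot> v \<longrightarrow> u = v)"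

text \<open>With \<open>u = (c, d)\<close>, \<open>v = (a, d)\<close> and \<open>w = (a, b)\<close>
  this asks for \<open>z = (c, b)\<close>. It is the classical inclusion of the composite of
  \<open>R\<close>, its opposite and \<open>R\<close> in \<open>R\<close>, stated on generalized
  elements so that no composition of relations has to be constructed.\<close>

definition difunctional :: "'o \<Rightarrow> 'm \<Rightarrow> 'm \<Rightarrow> bool" where
  "difunctional R d0 d1 \<longleftrightarrow>
     (\<forall>T u v w. u \<in> hom C T R \<and> v \<in> hom C T R \<and> w \<in> hom C T R \<and>
        d1 \<cdot> u = d1 \<cdot> v \<and> d0 \<cdot> v = d0 \<cdot> w \<longrightarrow>
        (\<exists>z. z \<in> hom C T R \<and> d0 \<cdot> z = d0 \<cdot> u \<and> d1 \<cdot> z = d1 \<cdot> w))"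

lemma internal_relation_iff:
  "internal_relation C X R d0 d1 \<longleftrightarrow> jointly_monic R d0 d1 \<and> Cod C d0 = X \<and> Cod C d1 = X"
  unfolding internal_relation_def jointly_monic_def hom_def by auto

lemma pullbackD:
  assumes "is_pullback C f g P p q"
  shows "f \<in> Arr C" "g \<in> Arr C" "Cod C f = Cod C g" "p \<in> Arr C" "q \<in> Arr C"
    "Dom C p = P" "Dom C q = P" "Cod C p = Dom C f" "Cod C q = Dom C g" "f \<cdot> p = g \<cdot> q"
  using assms by (auto simp: is_pullback_def hom_def)

lemma pullback_lift:
  assumes "is_pullback C f g P p q" "a \<in> Arr C" "b \<in> Arr C" "Dom C a = Dom C b"
    "Cod C a = Dom C f" "Cod C b = Dom C g" "f \<cdot> a = g \<cdot> b"
  obtains h where "h \<in> Arr C" "Dom C h = Dom C a" "Cod C h = P" "p \<cdot> h = a" "q \<cdot> h = b"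
proof -
  have "a \<in> hom C (Dom C a) (Dom C f)" "b \<in> hom C (Dom C a) (Dom C g)"
    using assms by auto
  then obtain h where "h \<in> hom C (Dom C a) P" "p \<cdot> h = a" "q \<cdot> h = b"
    using assms unfolding is_pullback_def by meson
  then show ?thesis using that by (auto simp: hom_def)
qed

lemma pullback_jointly_monic:
  assumes pb: "is_pullback C f g P p q"
  shows "jointly_monic P p q"
proof -
  note D = pullbackD[OF pb]
  have "u = v" if u: "u \<in> hom C T P" and v: "v \<in> hom C T P"
    and eq: "p \<cdot> u = p \<cdot> v" "q \<cdot> u = q \<cdot> v" for T u v
  proof -
    have 1: "p \<cdot> v \<in> hom C T (Dom C f)" "q \<cdot> v \<in> hom C T (Dom C g)"
      using v D by (auto simp: hom_def)
    moreover have "f \<cdot> (p \<cdot> v) = g \<cdot> (q \<cdot> v)"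
      using v D by - (rule whisker; auto simp: hom_def)
    ultimately have "\<exists>!h. h \<in> hom C T P \<and> p \<cdot> h = p \<cdot> v \<and> q \<cdot> h = q \<cdot> v"
      using pb unfolding is_pullback_def by blast
    with u v eq show ?thesis by blast
  qed
  then show ?thesis unfolding jointly_monic_def using D by blast
qed

lemma jointly_monicD:
  assumes "jointly_monic R d0 d1" "u \<in> Arr C" "v \<in> Arr C" "Dom C u = Dom C v"
    "Cod C u = R" "Cod C v = R" "d0 \<cdot> u = d0 \<cdot> v" "d1 \<cdot> u = d1 \<cdot> v"
  shows "u = v"
proof -
  have "u \<in> hom C (Dom C u) R" "v \<in> hom C (Dom C u) R" using assms by auto
  then show ?thesis using assms(1,7,8) unfolding jointly_monic_def by blast
qed

lemma monicD:
  assumes "monic m" "u \<in> Arr C" "v \<in> Arr C" "Dom C u = Dom C v"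
    "Cod C u = Dom C m" "Cod C v = Dom C m" "m \<cdot> u = m \<cdot> v"
  shows "u = v"
proof -
  have "u \<in> hom C (Dom C u) (Dom C m)" "v \<in> hom C (Dom C u) (Dom C m)" using assms by auto
  then show ?thesis using assms(1,7) unfolding monic_def by blast
qed

section \<open>Coequalizers and regular epimorphisms\<close>

lemma coequalizer_lift:
  assumes "is_coequalizer C u v e" "k \<in> Arr C" "Dom C k = Cod C u" "k \<cdot> u = k \<cdot> v"
  obtains h where "h \<in> Arr C" "Dom C h = Cod C e" "Cod C h = Cod C k" "h \<cdot> e = k"
proof -
  have "k \<in> hom C (Cod C u) (Cod C k)" using assms by auto
  then obtain h where "h \<in> hom C (Cod C e) (Cod C k)" "h \<cdot> e = k"
    using assms unfolding is_coequalizer_def by meson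
  then show ?thesis using that by (auto simp: hom_def)
qed

lemma coequalizerD:
  assumes "is_coequalizer C u v e"
  shows "u \<in> Arr C" "v \<in> Arr C" "e \<in> Arr C" "Dom C u = Dom C v" "Cod C u = Cod C v"
    "Dom C e = Cod C u" "Dom C e = Cod C v" "e \<cdot> u = e \<cdot> v"
  using assms by (auto simp: is_coequalizer_def)

lemma regular_epi_arr: "regular_epi C e \<Longrightarrow> e \<in> Arr C"
  by (auto simp: regular_epi_def is_coequalizer_def)

lemma regular_epi_cancel:
  assumes "regular_epi C e" "g \<in> Arr C" "h \<in> Arr C" "Cod C g = Cod C h"
    "Dom C g = Cod C e" "Dom C h = Cod C e" "g \<cdot> e = h \<cdot> e"
  shows "g = h"
proof -
  obtain u v where coeq: "is_coequalizer C u v e"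
    using assms(1) by (auto simp: regular_epi_def)
  note D = coequalizerD[OF coeq]
  have "h \<cdot> e \<in> hom C (Cod C u) (Cod C h)" using D assms by auto
  moreover have "(h \<cdot> e) \<cdot> u = (h \<cdot> e) \<cdot> v" using D assms by (simp add: assoc)
  ultimately have "\<exists>!k. k \<in> hom C (Cod C e) (Cod C h) \<and> k \<cdot> e = h \<cdot> e"
    using coeq unfolding is_coequalizer_def by blast
  moreover have "g \<in> hom C (Cod C e) (Cod C h)" "h \<in> hom C (Cod C e) (Cod C h)"
    using assms by auto
  ultimately show ?thesis using assms(7) by blast
qed

text \<open>A split epimorphism is the coequalizer of the idempotent \<open>s \<cdot> f\<close> and
  the identity; the factorization of \<open>k\<close> is \<open>k \<cdot> s\<close>.\<close>

lemma split_epi_regular_epi: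
  assumes "split_epi_with_section C X Y f s"
  shows "regular_epi C f"
proof -
  have D: "f \<in> Arr C" "s \<in> Arr C" "Dom C f = X" "Cod C f = Y" "Dom C s = Y" "Cod C s = X"
    "f \<cdot> s = Ident C Y"
    using assms by (auto simp: split_epi_with_section_def hom_def)
  have "X \<in> Obj C" using D obj_simps by blast
  note D = D this
  have "\<exists>!h. h \<in> hom C Y T \<and> h \<cdot> f = k"
    if k: "k \<in> hom C X T" "k \<cdot> (s \<cdot> f) = k \<cdot> Ident C X" for T k
  proof (rule ex1I[of _ "k \<cdot> s"])
    note K = homD[OF k(1)]
    show "k \<cdot> s \<in> hom C Y T \<and> (k \<cdot> s) \<cdot> f = k" 
      using k(2) K D by (auto simp: assoc)
    fix h assume h: "h \<in> hom C Y T \<and> h \<cdot> f = k"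
    then have H: "h \<in> Arr C" "Dom C h = Y" by (auto simp: hom_def)
    with h have "k \<cdot> s = h \<cdot> (f \<cdot> s)" using D by (auto simp: assoc)
    then show "h = k \<cdot> s" using H D by simp
  qed
  moreover have "f \<cdot> (s \<cdot> f) = f \<cdot> Ident C X"
    using whisker1[OF D(7), of f] D by simp
  ultimately have "is_coequalizer C (s \<cdot> f) (Ident C X) f"
    unfolding is_coequalizer_def using D by auto
  then show ?thesis by (auto simp: regular_epi_def)
qed

text \<open>Regular epimorphisms are extremal. Cancelling \<open>m\<close> shows that
  \<open>g\<close> identifies the pair coequalized by \<open>t\<close>, so
  \<open>g = k \<cdot> t\<close>; then \<open>m \<cdot> k\<close> is an identity because
  \<open>t\<close> cancels on the right, and \<open>k \<cdot> m\<close> because \<open>m\<close>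
  cancels on the left.\<close>

lemma regular_epi_through_monic:
  assumes t: "regular_epi C t" and m: "monic m"
    and g: "g \<in> Arr C" "Dom C g = Dom C t" "Cod C g = Dom C m" and eq: "m \<cdot> g = t"
  obtains k where "k \<in> Arr C" "Dom C k = Cod C m" "Cod C k = Dom C m"
    "m \<cdot> k = Ident C (Cod C m)" "k \<cdot> m = Ident C (Dom C m)"
proof -
  obtain u v where coeq: "is_coequalizer C u v t"
    using t by (auto simp: regular_epi_def)
  note D = coequalizerD[OF coeq]
  have mA: "m \<in> Arr C" using m by (simp add: monic_def)
  have ct: "Cod C t = Cod C m" using eq g mA by auto
  have "m \<cdot> (g \<cdot> u) = m \<cdot> (g \<cdot> v)"
    using D g mA eq by (simp flip: assoc)
  then have "g \<cdot> u = g \<cdot> v"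
    using D g mA by - (rule monicD[OF m]; auto)
  then obtain k where k: "k \<in> Arr C" "Dom C k = Cod C t" "Cod C k = Cod C g" "k \<cdot> t = g"
    using coequalizer_lift[OF coeq, of g] D g by auto
  have "m \<cdot> (k \<cdot> t) = Ident C (Cod C m) \<cdot> t"
    using k eq D g mA ct by simp
  then have mk: "m \<cdot> k = Ident C (Cod C m)"
    using k g mA ct D by - (rule regular_epi_cancel[OF t]; auto simp: assoc)
  have "m \<cdot> (k \<cdot> m) = m \<cdot> Ident C (Dom C m)"
    using whisker1[OF mk, of m] k g mA ct by simp
  then have "k \<cdot> m = Ident C (Dom C m)"
    using k g mA ct by - (rule monicD[OF m]; auto)
  then show ?thesis using that k ct g mk by auto
qed

lemma regular_epi_comp_iso:
  assumes e: "regular_epi C e" and m: "m \<in> Arr C" "Dom C m = Cod C e"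
    and k: "k \<in> Arr C" "Dom C k = Cod C m" "Cod C k = Dom C m"
    and inv: "m \<cdot> k = Ident C (Cod C m)" "k \<cdot> m = Ident C (Dom C m)"
  shows "regular_epi C (m \<cdot> e)"
proof -
  obtain u v where coeq: "is_coequalizer C u v e"
    using e by (auto simp: regular_epi_def)
  note D = coequalizerD[OF coeq]
  have "\<exists>!h. h \<in> hom C (Cod C m) T \<and> h \<cdot> (m \<cdot> e) = g"
    if g: "g \<in> hom C (Cod C u) T" "g \<cdot> u = g \<cdot> v" for T g
  proof -
    obtain h where h: "h \<in> Arr C" "Dom C h = Cod C e" "Cod C h = T" "h \<cdot> e = g"
      using coequalizer_lift[OF coeq, of g] g by (auto simp: hom_def)
    show ?thesis
    proof (rule ex1I[of _ "h \<cdot> k"])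
      have "k \<cdot> (m \<cdot> e) = e" using whisker1[OF inv(2), of e] m k D by simp
      then show "h \<cdot> k \<in> hom C (Cod C m) T \<and> (h \<cdot> k) \<cdot> (m \<cdot> e) = g"
        using h m k D by (auto simp: assoc)
    next
      fix h' assume h': "h' \<in> hom C (Cod C m) T \<and> h' \<cdot> (m \<cdot> e) = g"
      then have H: "h' \<in> Arr C" "Dom C h' = Cod C m" "Cod C h' = T" by (auto simp: hom_def)
      have "h' \<cdot> m = h"
        using h h' H m D by - (rule regular_epi_cancel[OF e]; auto simp: assoc)
      then have "h \<cdot> k = h' \<cdot> (m \<cdot> k)" using H m k by (auto simp: assoc)
      then show "h' = h \<cdot> k" using inv H by simp
    qed
  qed
  moreover have "(m \<cdot> e) \<cdot> u = (m \<cdot> e) \<cdot> v" using D m by (simp add: assoc)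
  ultimately have "is_coequalizer C u v (m \<cdot> e)"
    unfolding is_coequalizer_def using D m by auto
  then show ?thesis by (auto simp: regular_epi_def)
qed

end


section \<open>Pullbacks and equalizers from finite completeness\<close>

text \<open>The shape with objects \<open>0, \<dots>, n - 1\<close> and \<open>k\<close> non-identity arrows \<open>src i \<rightarrow> tgt i\<close>, the
  \<open>i\<close>-th one encoded as \<open>n + i\<close>. If no target is a source, one factor of every composite is an
  identity.\<close>

definition graph_shape :: "nat \<Rightarrow> nat \<Rightarrow> (nat \<Rightarrow> nat) \<Rightarrow> (nat \<Rightarrow> nat) \<Rightarrow> (nat, nat) category" where
  "graph_shape n k src tgt =
     \<lparr>Obj = {..<n}, Arr = {..<n + k},
      Dom = (\<lambda>u. if u < n then u else src (u - n)),
      Cod = (\<lambda>u. if u < n then u else tgt (u - n)),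
      Ident = (\<lambda>i. i), Comp = (\<lambda>g f. if f < n then g else f)\<rparr>"

lemma category_graph_shape:
  assumes "\<And>i. i < k \<Longrightarrow> src i < n \<and> tgt i < n" "\<And>i j. i < k \<Longrightarrow> j < k \<Longrightarrow> src i \<noteq> tgt j"
  shows "category (graph_shape n k src tgt)"
proof -
  let ?J = "graph_shape n k src tgt"
  have lt: "u - n < k" if "u < n + k" "\<not> u < n" for u using that by linarith
  have comp: "u < n \<or> v < n" if "u < n + k" "v < n + k" "Cod ?J u = Dom ?J v" for u v
    using that assms(2)[OF lt lt, of v u] by (auto simp: graph_shape_def split: if_splits)
  have J: "Obj ?J = {..<n}" "Arr ?J = {..<n + k}" "Ident ?J = (\<lambda>i. i)"
    "Comp ?J = (\<lambda>g f. if f < n then g else f)" "\<And>i. i < n \<Longrightarrow> Dom ?J i = i"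
    "\<And>i. i < n \<Longrightarrow> Cod ?J i = i"
    by (simp_all add: graph_shape_def)
  have bound: "Dom ?J u < n" "Cod ?J u < n" if "u < n + k" for u
    using that assms(1)[OF lt, of u] by (auto simp: graph_shape_def)
  show ?thesis
  proof
    fix f X Y g Z assume "f \<in> hom ?J X Y" "g \<in> hom ?J Y Z"
    then show "g \<cdot>\<^bsub>?J\<^esub> f \<in> hom ?J X Z"
      using comp[of f g] by (auto simp: hom_def J)
  next
    fix f X Y assume "f \<in> hom ?J X Y"
    then show "Ident ?J Y \<cdot>\<^bsub>?J\<^esub> f = f" by (auto simp: hom_def J)
  next
    fix f X Y g Z h W
    assume "f \<in> hom ?J X Y" "g \<in> hom ?J Y Z" "h \<in> hom ?J Z W"
    then show "(h \<cdot>\<^bsub>?J\<^esub> g) \<cdot>\<^bsub>?J\<^esub> f = h \<cdot>\<^bsub>?J\<^esub> (g \<cdot>\<^bsub>?J\<^esub> f)"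
      by (auto simp: hom_def J)
  qed (use bound in \<open>auto simp: hom_def J\<close>)
qed

locale finitely_complete_category = category +
  assumes complete: "finitely_complete C"
begin

text \<open>Finite completeness without the encoding: identities impose no condition on a diagram or
  a cone, so only the vertices and the \<open>k\<close> proper arrows remain to be
  mentioned.\<close>

lemma graph_limit:
  fixes n k :: nat and src tgt :: "nat \<Rightarrow> nat"
  assumes shape: "\<forall>i<k. src i < n \<and> tgt i < n" "\<forall>i<k. \<forall>j<k. src i \<noteq> tgt j"
    and G: "\<forall>i<n. Go i \<in> Obj C" "\<forall>i<k. Gm i \<in> hom C (Go (src i)) (Go (tgt i))"
  shows "\<exists>\<pi> L. (\<forall>i<n. \<pi> i \<in> hom C L (Go i)) \<and> (\<forall>i<k. Gm i \<cdot> \<pi> (src i) = \<pi> (tgt i)) \<and>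
    (\<forall>T \<tau>. T \<in> Obj C \<and> (\<forall>i<n. \<tau> i \<in> hom C T (Go i)) \<and> (\<forall>i<k. Gm i \<cdot> \<tau> (src i) = \<tau> (tgt i)) \<longrightarrow>
      (\<exists>!h. h \<in> hom C T L \<and> (\<forall>i<n. \<pi> i \<cdot> h = \<tau> i)))"
proof -
  let ?J = "graph_shape n k src tgt"
  let ?F = "\<lambda>u. if u < n then Ident C (Go u) else Gm (u - n)"
  have lt: "u - n < k" if "u < n + k" "\<not> u < n" for u using that by linarith
  have S: "src (u - n) \<noteq> tgt (v - n)" if "u < n + k" "\<not> u < n" "v < n + k" "\<not> v < n" for u v
    using shape(2) lt that by blast
  have "is_functor ?J C Go ?F"
    unfolding is_functor_def
  proof (intro conjI ballI impI)
    show "Go i \<in> Obj C" if "i \<in> Obj ?J" for i using that G by (simp add: graph_shape_def)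
    show F: "?F u \<in> hom C (Go (Dom ?J u)) (Go (Cod ?J u))" if "u \<in> Arr ?J" for u
      using that G lt Ident_hom by (auto simp: graph_shape_def)
    show "?F (Ident ?J i) = Ident C (Go i)" if "i \<in> Obj ?J" for i
      using that by (simp add: graph_shape_def)
    show "?F (v \<cdot>\<^bsub>?J\<^esub> u) = ?F v \<cdot> ?F u"
      if uv: "u \<in> Arr ?J" "v \<in> Arr ?J" and c: "Cod ?J u = Dom ?J v" for u v
    proof (cases "u < n")
      case True
      then show ?thesis using uv c G F[of v]
        by (auto simp: graph_shape_def hom_def split: if_splits)
    next
      case False
      then have "v < n" using uv c S[of u] S[of v] by (force simp: graph_shape_def split: if_splits)
      then show ?thesis using False uv c F[of u]
        by (auto simp: graph_shape_def hom_def split: if_splits)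
    qed
  qed
  moreover have "finite (Obj ?J)" "finite (Arr ?J)" by (simp_all add: graph_shape_def)
  ultimately obtain L \<pi> where lim: "is_limit ?J C Go ?F L \<pi>"
    using complete category_graph_shape[of k src n tgt] shape
    unfolding finitely_complete_def by metis
  have cone_iff: "is_cone ?J C Go ?F T \<tau> \<longleftrightarrow> T \<in> Obj C \<and> (\<forall>i<n. \<tau> i \<in> hom C T (Go i)) \<and>
      (\<forall>i<k. Gm i \<cdot> \<tau> (src i) = \<tau> (tgt i))" (is "_ = ?R") for T \<tau>
  proof
    assume c: "is_cone ?J C Go ?F T \<tau>"
    have "Gm i \<cdot> \<tau> (src i) = \<tau> (tgt i)" if "i < k" for i
    proof -
      have "n + i \<in> Arr ?J" using that by (simp add: graph_shape_def)
      then have "?F (n + i) \<cdot> \<tau> (Dom ?J (n + i)) = \<tau> (Cod ?J (n + i))"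
        using c unfolding is_cone_def by blast
      then show ?thesis by (simp add: graph_shape_def)
    qed
    with c show ?R unfolding is_cone_def by (auto simp: graph_shape_def)
  next
    assume ?R
    then show "is_cone ?J C Go ?F T \<tau>"
      using lt by (auto simp: is_cone_def graph_shape_def hom_def)
  qed
  have "\<exists>!h. h \<in> hom C T L \<and> (\<forall>i<n. \<pi> i \<cdot> h = \<tau> i)" if "is_cone ?J C Go ?F T \<tau>" for T \<tau>
  proof -
    have "\<exists>!h. h \<in> hom C T L \<and> (\<forall>i \<in> Obj ?J. \<pi> i \<cdot> h = \<tau> i)"
      using lim that unfolding is_limit_def by blast
    then show ?thesis by (simp add: graph_shape_def Ball_def)
  qed
  moreover have "is_cone ?J C Go ?F L \<pi>" using lim unfolding is_limit_def by blast
  ultimately show ?thesis unfolding cone_iff by blast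
qed

lemma pullback_exists:
  assumes "f \<in> Arr C" "g \<in> Arr C" "Cod C f = Cod C g"
  obtains P p q where "is_pullback C f g P p q"
proof -
  \<comment> \<open>The cospan is the graph with arrows \<open>0 \<rightarrow> 2\<close> and
    \<open>1 \<rightarrow> 2\<close>.\<close>
  define Go where "Go = (\<lambda>i::nat. if i = 0 then Dom C f else if i = 1 then Dom C g else Cod C f)"
  define Gm where "Gm = (\<lambda>i::nat. if i = 0 then f else g)"
  have G: "\<forall>i<3. Go i \<in> Obj C" using assms by (auto simp: Go_def)
  have G': "\<forall>i<2. Gm i \<in> hom C (Go i) (Go 2)"
    using assms by (auto simp: Go_def Gm_def less_2_cases_iff)
  have shape: "\<forall>i<2::nat. i < 3 \<and> 2 < (3::nat)" "\<forall>i<2::nat. \<forall>j<2::nat. i \<noteq> (2::nat)"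
    by auto
  obtain \<pi> L where L: "\<forall>i<3. \<pi> i \<in> hom C L (Go i)" "\<forall>i<2. Gm i \<cdot> \<pi> i = \<pi> 2"
    and univ: "\<forall>T \<tau>. T \<in> Obj C \<and> (\<forall>i<3. \<tau> i \<in> hom C T (Go i)) \<and> (\<forall>i<2. Gm i \<cdot> \<tau> i = \<tau> 2) \<longrightarrow>
      (\<exists>!h. h \<in> hom C T L \<and> (\<forall>i<3. \<pi> i \<cdot> h = \<tau> i))"
    using graph_limit[of 2 "\<lambda>i. i" 3 "\<lambda>i. 2" Go Gm, OF shape G G'] by blast
  have p: "\<pi> 0 \<in> hom C L (Dom C f)" "\<pi> 1 \<in> hom C L (Dom C g)"
    using L(1)[rule_format, of 0] L(1)[rule_format, of 1] by (simp_all add: Go_def)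
  have eq: "f \<cdot> \<pi> 0 = \<pi> 2" "g \<cdot> \<pi> 1 = \<pi> 2"
    using L(2)[rule_format, of 0] L(2)[rule_format, of 1] by (simp_all add: Gm_def)
  have "\<exists>!h. h \<in> hom C T L \<and> \<pi> 0 \<cdot> h = a \<and> \<pi> 1 \<cdot> h = b"
    if ab: "a \<in> hom C T (Dom C f)" "b \<in> hom C T (Dom C g)" "f \<cdot> a = g \<cdot> b" for T a b
  proof -
    define \<tau> where "\<tau> = (\<lambda>i::nat. if i = 0 then a else if i = 1 then b else f \<cdot> a)"
    have "\<tau> i \<in> hom C T (Go i)" for i
      using ab assms homD[OF ab(1)] homD[OF ab(2)] by (auto simp: \<tau>_def Go_def)
    moreover have "i < 2 \<Longrightarrow> Gm i \<cdot> \<tau> i = \<tau> 2" for i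
      using ab by (auto simp: \<tau>_def Gm_def less_2_cases_iff)
    ultimately have u: "\<exists>!h. h \<in> hom C T L \<and> (\<forall>i<3. \<pi> i \<cdot> h = \<tau> i)"
      using univ hom_obj[OF ab(1)] by blast
    \<comment> \<open>The leg at vertex \<open>2\<close> is determined by the one at
      \<open>0\<close>, so the universal property for cones becomes the one for commuting
      pairs.\<close>
    have "(\<forall>i<3. \<pi> i \<cdot> h = \<tau> i) \<longleftrightarrow> \<pi> 0 \<cdot> h = a \<and> \<pi> 1 \<cdot> h = b" if h: "h \<in> hom C T L" for h
    proof -
      have "\<pi> 2 \<cdot> h = f \<cdot> (\<pi> 0 \<cdot> h)"
        using eq(1) homD[OF h] homD[OF p(1)] assms by (simp flip: assoc)
      then show ?thesis by (auto simp: \<tau>_def numeral_3_eq_3 numeral_2_eq_2 less_Suc_eq)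
    qed
    then have "h \<in> hom C T L \<and> (\<forall>i<3. \<pi> i \<cdot> h = \<tau> i) \<longleftrightarrow>
        h \<in> hom C T L \<and> \<pi> 0 \<cdot> h = a \<and> \<pi> 1 \<cdot> h = b" for h by blast
    with u show ?thesis by simp
  qed
  then have "is_pullback C f g L (\<pi> 0) (\<pi> 1)"
    unfolding is_pullback_def using assms p eq by simp
  then show ?thesis using that by blast
qed

lemma equalizer_exists:
  assumes "f \<in> hom C A B" "g \<in> hom C A B"
  obtains e L where "e \<in> hom C L A" "f \<cdot> e = g \<cdot> e" "monic e"
    "\<And>T a. a \<in> hom C T A \<Longrightarrow> f \<cdot> a = g \<cdot> a \<Longrightarrow> \<exists>h. h \<in> hom C T L \<and> e \<cdot> h = a"
proof -
  note fg = homD[OF assms(1)] homD[OF assms(2)]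
  \<comment> \<open>A parallel pair is the graph with two arrows
    \<open>0 \<rightarrow> 1\<close>.\<close>
  define Go where "Go = (\<lambda>i::nat. if i = 0 then A else B)"
  define Gm where "Gm = (\<lambda>i::nat. if i = 0 then f else g)"
  have G: "\<forall>i<2. Go i \<in> Obj C" using hom_obj[OF assms(1)] by (auto simp: Go_def)
  have G': "\<forall>i<2. Gm i \<in> hom C (Go 0) (Go 1)"
    using assms by (auto simp: Go_def Gm_def)
  have shape: "\<forall>i<2::nat. 0 < (2::nat) \<and> 1 < (2::nat)" "\<forall>i<2::nat. \<forall>j<2::nat. 0 \<noteq> (1::nat)"
    by auto
  obtain \<pi> L where L: "\<forall>i<2. \<pi> i \<in> hom C L (Go i)" "\<forall>i<2. Gm i \<cdot> \<pi> 0 = \<pi> 1"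
    and univ: "\<forall>T \<tau>. T \<in> Obj C \<and> (\<forall>i<2. \<tau> i \<in> hom C T (Go i)) \<and> (\<forall>i<2. Gm i \<cdot> \<tau> 0 = \<tau> 1) \<longrightarrow>
      (\<exists>!h. h \<in> hom C T L \<and> (\<forall>i<2. \<pi> i \<cdot> h = \<tau> i))"
    using graph_limit[of 2 "\<lambda>i. 0" 2 "\<lambda>i. 1" Go Gm, OF shape G G'] by blast
  have p: "\<pi> 0 \<in> hom C L A" using L(1)[rule_format, of 0] by (simp add: Go_def)
  have eq: "f \<cdot> \<pi> 0 = \<pi> 1" "g \<cdot> \<pi> 0 = \<pi> 1"
    using L(2)[rule_format, of 0] L(2)[rule_format, of 1] by (simp_all add: Gm_def)
  have ex1: "\<exists>!h. h \<in> hom C T L \<and> \<pi> 0 \<cdot> h = a"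
    if a: "a \<in> hom C T A" "f \<cdot> a = g \<cdot> a" for T a
  proof -
    define \<tau> where "\<tau> = (\<lambda>i::nat. if i = 0 then a else f \<cdot> a)"
    have "\<tau> i \<in> hom C T (Go i)" for i
      using a fg homD[OF a(1)] by (auto simp: \<tau>_def Go_def)
    moreover have "Gm i \<cdot> \<tau> 0 = \<tau> 1" for i
      using a by (auto simp: \<tau>_def Gm_def)
    ultimately have u: "\<exists>!h. h \<in> hom C T L \<and> (\<forall>i<2. \<pi> i \<cdot> h = \<tau> i)"
      using univ hom_obj[OF a(1)] by blast
    have "(\<forall>i<2. \<pi> i \<cdot> h = \<tau> i) \<longleftrightarrow> \<pi> 0 \<cdot> h = a" if h: "h \<in> hom C T L" for h
    proof -
      have "\<pi> 1 \<cdot> h = f \<cdot> (\<pi> 0 \<cdot> h)"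
        using eq(1) homD[OF h] homD[OF p] fg by (simp flip: assoc)
      then show ?thesis by (auto simp: \<tau>_def less_2_cases_iff)
    qed
    then have "h \<in> hom C T L \<and> (\<forall>i<2. \<pi> i \<cdot> h = \<tau> i) \<longleftrightarrow> h \<in> hom C T L \<and> \<pi> 0 \<cdot> h = a" for h
      by blast
    with u show ?thesis by simp
  qed
  have "monic (\<pi> 0)"
    unfolding monic_def
  proof (intro conjI allI impI)
    show "\<pi> 0 \<in> Arr C" using homD[OF p] by simp
    fix T u v
    assume uv: "u \<in> hom C T (Dom C (\<pi> 0)) \<and> v \<in> hom C T (Dom C (\<pi> 0)) \<and> \<pi> 0 \<cdot> u = \<pi> 0 \<cdot> v"
    then have uv': "u \<in> hom C T L" "v \<in> hom C T L" "\<pi> 0 \<cdot> u = \<pi> 0 \<cdot> v" using homD[OF p] by auto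
    have "\<pi> 0 \<cdot> v \<in> hom C T A" using homD[OF uv'(2)] homD[OF p] by auto
    moreover have "f \<cdot> (\<pi> 0 \<cdot> v) = g \<cdot> (\<pi> 0 \<cdot> v)"
      using eq homD[OF uv'(2)] homD[OF p] fg by - (rule whisker; auto)
    ultimately show "u = v" using ex1 uv' by blast
  qed
  then show ?thesis using that[of "\<pi> 0" L] p eq ex1 by metis
qed

section \<open>Inverse images of relations; difunctionality and the Mal'tsev condition\<close>

text \<open>\<open>S\<close> is the subobject of \<open>P\<close> on which \<open>(a, b)\<close>
  lies in \<open>R\<close>. It is obtained in two stages: a pullback makes the first coordinates
  agree, then an equalizer the second ones. The arrow \<open>z\<close> is the witness of membership
  in \<open>R\<close>.\<close>

lemma relation_inverse_image:
  assumes R: "jointly_monic R d0 d1"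
    and a: "a \<in> hom C P (Cod C d0)" and b: "b \<in> hom C P (Cod C d1)"
  obtains h S z where "monic h" "h \<in> hom C S P" "z \<in> hom C S R" "d0 \<cdot> z = a \<cdot> h" "d1 \<cdot> z = b \<cdot> h"
    "\<And>T g \<zeta>. \<lbrakk>g \<in> hom C T P; \<zeta> \<in> hom C T R; d0 \<cdot> \<zeta> = a \<cdot> g; d1 \<cdot> \<zeta> = b \<cdot> g\<rbrakk>
       \<Longrightarrow> \<exists>k. k \<in> hom C T S \<and> h \<cdot> k = g"
proof -
  note A = homD[OF a] homD[OF b]
  have D: "d0 \<in> Arr C" "d1 \<in> Arr C" "Dom C d0 = R" "Dom C d1 = R"
    using R by (auto simp: jointly_monic_def)
  obtain Q p y where pb: "is_pullback C a d0 Q p y"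
    using pullback_exists[of a d0] A D by auto
  note Q = pullbackD[OF pb]
  have "b \<cdot> p \<in> hom C Q (Cod C d1)" "d1 \<cdot> y \<in> hom C Q (Cod C d1)" using A D Q by auto
  then obtain S e where e: "e \<in> hom C S Q" "(b \<cdot> p) \<cdot> e = (d1 \<cdot> y) \<cdot> e" "monic e"
    and univ: "\<And>T c. c \<in> hom C T Q \<Longrightarrow> (b \<cdot> p) \<cdot> c = (d1 \<cdot> y) \<cdot> c
      \<Longrightarrow> \<exists>h. h \<in> hom C T S \<and> e \<cdot> h = c"
    by (rule equalizer_exists) blast
  note E = homD[OF e(1)]
  let ?h = "p \<cdot> e" and ?z = "y \<cdot> e"
  have h: "?h \<in> Arr C" "Dom C ?h = S" "Cod C ?h = P" "?z \<in> Arr C" "Dom C ?z = S" "Cod C ?z = R"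
    using A D Q E by auto
  have z0: "d0 \<cdot> ?z = a \<cdot> ?h" 
    using A D Q E by - (rule whisker; auto)
  have z1: "d1 \<cdot> ?z = b \<cdot> ?h"
    using e(2) A D Q E by (simp add: assoc)
  show ?thesis
  proof (rule that[of ?h S ?z])
    show "monic ?h"
      unfolding monic_def
    proof (intro conjI allI impI)
      show "?h \<in> Arr C" by fact
      fix T u v
      assume uv: "u \<in> hom C T (Dom C ?h) \<and> v \<in> hom C T (Dom C ?h) \<and> ?h \<cdot> u = ?h \<cdot> v"
      then have U: "u \<in> Arr C" "v \<in> Arr C" "Dom C u = T" "Dom C v = T" "Cod C u = S" "Cod C v = S"
        and eq: "?h \<cdot> u = ?h \<cdot> v" using h by (auto simp: hom_def)
      \<comment> \<open>The witness is determined by the element of \<open>P\<close>, because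
        \<open>R\<close> is jointly monic; hence equality after \<open>?h\<close> gives equality in
        both components of the pullback \<open>Q\<close>.\<close>
      have "d0 \<cdot> (?z \<cdot> u) = d0 \<cdot> (?z \<cdot> v)" "d1 \<cdot> (?z \<cdot> u) = d1 \<cdot> (?z \<cdot> v)"
        using whisker[OF z0, of u] whisker[OF z0, of v] whisker[OF z1, of u] whisker[OF z1, of v]
          eq U h A D by auto
      then have "?z \<cdot> u = ?z \<cdot> v"
        using U h by - (rule jointly_monicD[OF R]; auto)
      then have "e \<cdot> u = e \<cdot> v"
        using eq U Q E A by - (rule jointly_monicD[OF pullback_jointly_monic[OF pb]]; auto simp: assoc)
      then show "u = v" using U E by - (rule monicD[OF e(3)]; auto)
    qed
    show "?h \<in> hom C S P" "?z \<in> hom C S R" using h by auto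
    show "d0 \<cdot> ?z = a \<cdot> ?h" "d1 \<cdot> ?z = b \<cdot> ?h" by fact+
    fix T g \<zeta>
    assume g: "g \<in> hom C T P" "\<zeta> \<in> hom C T R" "d0 \<cdot> \<zeta> = a \<cdot> g" "d1 \<cdot> \<zeta> = b \<cdot> g"
    note G = homD[OF g(1)] homD[OF g(2)]
    obtain c where c: "c \<in> Arr C" "Dom C c = T" "Cod C c = Q" "p \<cdot> c = g" "y \<cdot> c = \<zeta>"
      using pullback_lift[OF pb, of g \<zeta>] G g A D by auto
    have "(b \<cdot> p) \<cdot> c = (d1 \<cdot> y) \<cdot> c" using c g A D Q by (simp add: assoc)
    moreover have "c \<in> hom C T Q" using c by auto
    ultimately obtain k where k: "k \<in> hom C T S" "e \<cdot> k = c" using univ by blast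
    have "?h \<cdot> k = g" using homD[OF k(1)] k(2) E Q c by (simp add: assoc)
    with k show "\<exists>k. k \<in> hom C T S \<and> ?h \<cdot> k = g" by blast
  qed
qed

text \<open>Elementwise, the relation \<open>i \<sim> j \<longleftrightarrow> (d0 i, d1 j) \<in> R\<close> on \<open>R\<close> is reflexive; its symmetry is
  difunctionality of \<open>R\<close>. The witness of \<open>(d0 i, d1 j) \<in> R\<close> is \<open>k0 \<cdot> p\<close>.\<close>

lemma maltsev_difunctional:
  assumes maltsev: "maltsev_category C" and R: "jointly_monic R d0 d1"
  shows "difunctional R d0 d1"
proof -
  have D: "d0 \<in> Arr C" "d1 \<in> Arr C" "Dom C d0 = R" "Dom C d1 = R" and RO: "R \<in> Obj C"
    using R obj_simps by (auto simp: jointly_monic_def)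
  \<comment> \<open>An element of \<open>Q\<close> is a triple \<open>(i, k, j)\<close> in
    \<open>R\<close> with \<open>d0 k = d0 i\<close> and \<open>d1 k = d1 j\<close>, so that
    \<open>k\<close> is \<open>(d0 i, d1 j)\<close>. The legs of the new relation are
    \<open>i\<close> and \<open>j\<close>.\<close>
  obtain K i0 k0 where K: "is_pullback C d0 d0 K i0 k0"
    using pullback_exists[of d0 d0] D by auto
  note KD = pullbackD[OF K]
  obtain Q p j where Q: "is_pullback C (d1 \<cdot> k0) d1 Q p j"
    using pullback_exists[of "d1 \<cdot> k0" d1] D KD by auto
  note QD = pullbackD[OF Q]
  have ty: "i0 \<in> Arr C" "k0 \<in> Arr C" "Dom C i0 = K" "Dom C k0 = K" "Cod C i0 = R" "Cod C k0 = R"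
    "p \<in> Arr C" "j \<in> Arr C" "Dom C p = Q" "Dom C j = Q" "Cod C p = K" "Cod C j = R"
    using D KD QD by auto
  have e0: "d0 \<cdot> (i0 \<cdot> p) = d0 \<cdot> (k0 \<cdot> p)"
    using D ty KD(10) by - (rule whisker; auto)
  have e1: "d1 \<cdot> (k0 \<cdot> p) = d1 \<cdot> j"
    using QD(10) D ty by (simp add: assoc)
  have "jointly_monic Q (i0 \<cdot> p) j"
    unfolding jointly_monic_def
  proof (intro conjI allI impI)
    fix T u v
    assume uv: "u \<in> hom C T Q \<and> v \<in> hom C T Q \<and> (i0 \<cdot> p) \<cdot> u = (i0 \<cdot> p) \<cdot> v \<and> j \<cdot> u = j \<cdot> v"
    then have U: "u \<in> Arr C" "v \<in> Arr C" "Dom C u = T" "Dom C v = T" "Cod C u = Q" "Cod C v = Q"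
      and i: "(i0 \<cdot> p) \<cdot> u = (i0 \<cdot> p) \<cdot> v" and j: "j \<cdot> u = j \<cdot> v" by (auto simp: hom_def)
    \<comment> \<open>The middle component \<open>k\<close> is determined by \<open>i\<close> and
      \<open>j\<close>, as both its coordinates are.\<close>
    have "d0 \<cdot> ((k0 \<cdot> p) \<cdot> w) = d0 \<cdot> ((i0 \<cdot> p) \<cdot> w)" "d1 \<cdot> ((k0 \<cdot> p) \<cdot> w) = d1 \<cdot> (j \<cdot> w)"
      if "w \<in> Arr C" "Cod C w = Q" for w
      using that D ty whisker[OF e0, of w] whisker[OF e1, of w] by auto
    then have "d0 \<cdot> ((k0 \<cdot> p) \<cdot> u) = d0 \<cdot> ((k0 \<cdot> p) \<cdot> v)" "d1 \<cdot> ((k0 \<cdot> p) \<cdot> u) = d1 \<cdot> ((k0 \<cdot> p) \<cdot> v)"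
      using U i j by auto
    then have "(k0 \<cdot> p) \<cdot> u = (k0 \<cdot> p) \<cdot> v"
      using U ty by - (rule jointly_monicD[OF R]; auto)
    with i have "i0 \<cdot> (p \<cdot> u) = i0 \<cdot> (p \<cdot> v)" "k0 \<cdot> (p \<cdot> u) = k0 \<cdot> (p \<cdot> v)"
      using U ty by (simp_all add: assoc)
    then have "p \<cdot> u = p \<cdot> v"
      using U ty by - (rule jointly_monicD[OF pullback_jointly_monic[OF K]]; auto)
    then show "u = v"
      using U ty j by - (rule jointly_monicD[OF pullback_jointly_monic[OF Q]]; auto)
  qed (use ty in auto)
  then have "internal_relation C R Q (i0 \<cdot> p) j"
    unfolding internal_relation_iff using ty by simp
  \<comment> \<open>Reflexivity is given by the triples \<open>(i, i, i)\<close>.\<close>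
  moreover obtain \<delta> where \<delta>: "\<delta> \<in> Arr C" "Dom C \<delta> = R" "Cod C \<delta> = K"
    "i0 \<cdot> \<delta> = Ident C R" "k0 \<cdot> \<delta> = Ident C R"
    using pullback_lift[OF K, of "Ident C R" "Ident C R"] RO D by auto
  moreover have "(d1 \<cdot> k0) \<cdot> \<delta> = d1 \<cdot> Ident C R" using \<delta> D ty by (simp add: assoc)
  then obtain \<rho> where \<rho>: "\<rho> \<in> Arr C" "Dom C \<rho> = R" "Cod C \<rho> = Q" "p \<cdot> \<rho> = \<delta>" "j \<cdot> \<rho> = Ident C R"
    using pullback_lift[OF Q, of \<delta> "Ident C R"] RO D \<delta> ty by auto
  moreover have "(i0 \<cdot> p) \<cdot> \<rho> = Ident C R" using \<rho> \<delta> ty by (simp add: assoc)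
  ultimately have "reflexive_relation C R Q (i0 \<cdot> p) j"
    unfolding reflexive_relation_def by auto
  then have "symmetric_relation C R Q (i0 \<cdot> p) j"
    using maltsev unfolding maltsev_category_def equivalence_relation_def by blast
  then obtain \<sigma> where "\<sigma> \<in> hom C Q Q" and s0: "(i0 \<cdot> p) \<cdot> \<sigma> = j" and s1: "j \<cdot> \<sigma> = i0 \<cdot> p"
    unfolding symmetric_relation_def by blast
  then have \<sigma>: "\<sigma> \<in> Arr C" "Dom C \<sigma> = Q" "Cod C \<sigma> = Q" by (auto simp: hom_def)
  \<comment> \<open>Since \<open>\<sigma>\<close> exchanges \<open>i\<close> and \<open>j\<close>,
    the middle component after \<open>\<sigma>\<close> is the pair
    \<open>(d0 j, d1 i)\<close>.\<close>
  let ?z = "(k0 \<cdot> p) \<cdot> \<sigma>"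
  have z0: "d0 \<cdot> ?z = d0 \<cdot> j"
    using whisker[OF e0, of \<sigma>] s0 \<sigma> D ty by simp
  have z1: "d1 \<cdot> ?z = d1 \<cdot> (i0 \<cdot> p)"
    using whisker[OF e1, of \<sigma>] s1 \<sigma> D ty by simp
  show ?thesis
    unfolding difunctional_def
  proof (intro allI impI)
    fix T u v w
    assume "u \<in> hom C T R \<and> v \<in> hom C T R \<and> w \<in> hom C T R \<and>
      d1 \<cdot> u = d1 \<cdot> v \<and> d0 \<cdot> v = d0 \<cdot> w"
    then have U: "u \<in> Arr C" "v \<in> Arr C" "w \<in> Arr C" "Dom C u = T" "Dom C v = T" "Dom C w = T"
      "Cod C u = R" "Cod C v = R" "Cod C w = R"
      and eq: "d1 \<cdot> u = d1 \<cdot> v" "d0 \<cdot> v = d0 \<cdot> w" by (auto simp: hom_def)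
    \<comment> \<open>The hypotheses say that \<open>(w, v, u)\<close> is an element of
      \<open>Q\<close>, in the order \<open>i\<close>, \<open>k\<close>, \<open>j\<close>;
      \<open>?z\<close> applied to it has first coordinate that of \<open>u\<close> and second that
      of \<open>w\<close>.\<close>
    obtain a where a: "a \<in> Arr C" "Dom C a = T" "Cod C a = K" "i0 \<cdot> a = w" "k0 \<cdot> a = v"
      using pullback_lift[OF K, of w v] U eq D by auto
    moreover have "(d1 \<cdot> k0) \<cdot> a = d1 \<cdot> u" using a eq D ty by (simp add: assoc)
    ultimately obtain b where b: "b \<in> Arr C" "Dom C b = T" "Cod C b = Q" "p \<cdot> b = a" "j \<cdot> b = u"
      using pullback_lift[OF Q, of a u] U D ty by auto
    have "(i0 \<cdot> p) \<cdot> b = w" using a b ty by (simp add: assoc)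
    then have "d0 \<cdot> (?z \<cdot> b) = d0 \<cdot> u" "d1 \<cdot> (?z \<cdot> b) = d1 \<cdot> w"
      using whisker[OF z0, of b] whisker[OF z1, of b] b \<sigma> D ty by auto
    moreover have "?z \<cdot> b \<in> hom C T R" using b \<sigma> ty by auto
    ultimately show "\<exists>z. z \<in> hom C T R \<and> d0 \<cdot> z = d0 \<cdot> u \<and> d1 \<cdot> z = d1 \<cdot> w" by blast
  qed
qed

text \<open>Symmetry is difunctionality applied to \<open>(b, b), (a, b), (a, a)\<close>, transitivity is
  difunctionality applied to \<open>(a, b), (b, b), (b, c)\<close>.\<close>

lemma difunctional_maltsev:
  assumes difun: "\<And>R d0 d1. jointly_monic R d0 d1 \<Longrightarrow> difunctional R d0 d1"
  shows "maltsev_category C"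
  unfolding maltsev_category_def
proof (intro conjI allI impI)
  show "category C" by (rule category_axioms)
  show "finitely_complete C" by (rule complete)
  fix X R d0 d1
  assume refl: "reflexive_relation C X R d0 d1"
  then have rel: "internal_relation C X R d0 d1" by (simp add: reflexive_relation_def)
  then have jm: "jointly_monic R d0 d1" and X: "Cod C d0 = X" "Cod C d1 = X"
    by (auto simp: internal_relation_iff)
  have D: "d0 \<in> Arr C" "d1 \<in> Arr C" "Dom C d0 = R" "Dom C d1 = R" and RO: "R \<in> Obj C"
    using jm obj_simps by (auto simp: jointly_monic_def)
  obtain r where "r \<in> hom C X R" and r: "d0 \<cdot> r = Ident C X" "d1 \<cdot> r = Ident C X"
    using refl by (auto simp: reflexive_relation_def)
  then have rD: "r \<in> Arr C" "Dom C r = X" "Cod C r = R" by (auto simp: hom_def)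
  have dr: "d0 \<cdot> (r \<cdot> w) = w" "d1 \<cdot> (r \<cdot> w) = w" if "w \<in> Arr C" "Cod C w = X" for w
    using whisker1[OF r(1), of w] whisker1[OF r(2), of w] that rD D X by auto
  have difunD: "\<exists>z. z \<in> hom C T R \<and> d0 \<cdot> z = d0 \<cdot> u \<and> d1 \<cdot> z = d1 \<cdot> w"
    if "u \<in> hom C T R" "v \<in> hom C T R" "w \<in> hom C T R" "d1 \<cdot> u = d1 \<cdot> v" "d0 \<cdot> v = d0 \<cdot> w" for T u v w
    using difun[OF jm] that unfolding difunctional_def by blast
  have "symmetric_relation C X R d0 d1"
  proof -
    have "\<exists>z. z \<in> hom C R R \<and> d0 \<cdot> z = d0 \<cdot> (r \<cdot> d1) \<and> d1 \<cdot> z = d1 \<cdot> (r \<cdot> d0)"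
      by (rule difunD[of _ _ "Ident C R"]) (use D X rD RO dr in auto)
    then show ?thesis
      unfolding symmetric_relation_def using rel dr D X by auto
  qed
  moreover have "transitive_relation C X R d0 d1"
    unfolding transitive_relation_def
  proof (intro conjI allI impI)
    show "internal_relation C X R d0 d1" by (rule rel)
    fix P p q
    assume pb: "is_pullback C d1 d0 P p q"
    note PD = pullbackD[OF pb]
    show "\<exists>t. t \<in> hom C P R \<and> d0 \<cdot> t = d0 \<cdot> p \<and> d1 \<cdot> t = d1 \<cdot> q"
      by (rule difunD[of _ _ "r \<cdot> (d1 \<cdot> p)"]) (use D X rD PD dr in auto)
  qed
  ultimately show "equivalence_relation C X R d0 d1"
    using refl by (simp add: equivalence_relation_def)
qed

section \<open>From regular pushouts to difunctionality\<close>

definition split_squares_regular_pushouts :: bool where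
  "split_squares_regular_pushouts \<longleftrightarrow>
    (\<forall>X' Y' X Y f' s' f s x y.
       split_epi_with_section C X' Y' f' s' \<and>
       split_epi_with_section C X Y f s \<and>
       x \<in> hom C X' X \<and> regular_epi C x \<and>
       y \<in> hom C Y' Y \<and> regular_epi C y \<and>
       f \<cdot> x = y \<cdot> f' \<and>
       x \<cdot> s' = s \<cdot> y \<longrightarrow>
       regular_pushout C f' x y f)"

text \<open>With \<open>K1\<close> and \<open>K0\<close> the kernel pairs of \<open>d1\<close> and \<open>d0\<close>, the pullback \<open>P = K1 \<times>\<^sub>R K0\<close> consists of
  the triples \<open>(c, d), (a, d), (a, b)\<close> in \<open>R\<close>. Let \<open>S \<subseteq> P\<close> consist of those with \<open>(c, b) \<in> R\<close>. The
  sections \<open>b = d\<close> of \<open>P \<rightarrow> K1\<close> and \<open>c = a\<close> of \<open>P \<rightarrow> K0\<close> both factor through \<open>S\<close>, so \<open>S \<rightarrow> P\<close>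
  comes from a square of split epimorphisms and is both regular epi and monic.\<close>

lemma squares_difunctional:
  assumes squares: split_squares_regular_pushouts and R: "jointly_monic R d0 d1"
  shows "difunctional R d0 d1"
proof -
  have D: "d0 \<in> Arr C" "d1 \<in> Arr C" "Dom C d0 = R" "Dom C d1 = R" and RO: "R \<in> Obj C"
    using R obj_simps by (auto simp: jointly_monic_def)
  obtain K1 u1 v1 where K1: "is_pullback C d1 d1 K1 u1 v1"
    using pullback_exists[of d1 d1] D by auto
  obtain K0 v0 w0 where K0: "is_pullback C d0 d0 K0 v0 w0"
    using pullback_exists[of d0 d0] D by auto
  have K: "u1 \<in> Arr C" "v1 \<in> Arr C" "Dom C u1 = K1" "Dom C v1 = K1" "Cod C u1 = R" "Cod C v1 = R"
    "v0 \<in> Arr C" "w0 \<in> Arr C" "Dom C v0 = K0" "Dom C w0 = K0" "Cod C v0 = R" "Cod C w0 = R"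
    using pullbackD[OF K1] pullbackD[OF K0] D by auto
  have KO: "K1 \<in> Obj C" "K0 \<in> Obj C" using K obj_simps by blast+
  have e1: "d1 \<cdot> u1 = d1 \<cdot> v1" and e0: "d0 \<cdot> v0 = d0 \<cdot> w0"
    using pullbackD[OF K1] pullbackD[OF K0] by auto
  obtain P p q where P: "is_pullback C v1 v0 P p q"
    using pullback_exists[of v1 v0] K by auto
  have PD: "p \<in> Arr C" "q \<in> Arr C" "Dom C p = P" "Dom C q = P" "Cod C p = K1" "Cod C q = K0"
    "v1 \<cdot> p = v0 \<cdot> q"
    using pullbackD[OF P] K by auto
  have "u1 \<cdot> p \<in> hom C P R" "w0 \<cdot> q \<in> hom C P R" using K PD by auto
  then have "d0 \<cdot> (u1 \<cdot> p) \<in> hom C P (Cod C d0)" "d1 \<cdot> (w0 \<cdot> q) \<in> hom C P (Cod C d1)"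
    using D by (auto simp: hom_def)
  \<comment> \<open>A triple is \<open>(u1 \<cdot> p, v1 \<cdot> p, w0 \<cdot> q)\<close> with
    \<open>v1 \<cdot> p = v0 \<cdot> q\<close>; the two arrows restricted to \<open>S\<close> read
    off \<open>c\<close> and \<open>b\<close>.\<close>
  then obtain h S z where h: "monic h" "h \<in> hom C S P" and z: "z \<in> hom C S R"
    "d0 \<cdot> z = (d0 \<cdot> (u1 \<cdot> p)) \<cdot> h" "d1 \<cdot> z = (d1 \<cdot> (w0 \<cdot> q)) \<cdot> h"
    and univ: "\<And>T g \<zeta>. \<lbrakk>g \<in> hom C T P; \<zeta> \<in> hom C T R; d0 \<cdot> \<zeta> = (d0 \<cdot> (u1 \<cdot> p)) \<cdot> g;
      d1 \<cdot> \<zeta> = (d1 \<cdot> (w0 \<cdot> q)) \<cdot> g\<rbrakk> \<Longrightarrow> \<exists>k. k \<in> hom C T S \<and> h \<cdot> k = g"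
    using relation_inverse_image[OF R] by metis
  have hD: "h \<in> Arr C" "Dom C h = S" "Cod C h = P" using h by (auto simp: hom_def)
  obtain \<delta>1 where \<delta>1: "\<delta>1 \<in> Arr C" "Dom C \<delta>1 = R" "Cod C \<delta>1 = K1"
    "u1 \<cdot> \<delta>1 = Ident C R" "v1 \<cdot> \<delta>1 = Ident C R"
    using pullback_lift[OF K1, of "Ident C R" "Ident C R"] RO D by auto
  obtain \<delta>0 where \<delta>0: "\<delta>0 \<in> Arr C" "Dom C \<delta>0 = R" "Cod C \<delta>0 = K0"
    "v0 \<cdot> \<delta>0 = Ident C R" "w0 \<cdot> \<delta>0 = Ident C R"
    using pullback_lift[OF K0, of "Ident C R" "Ident C R"] RO D by auto
  \<comment> \<open>\<open>c1\<close> sends \<open>(u, v)\<close> to the triple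
    \<open>(u, v, v)\<close>, whose conclusion \<open>(c, d)\<close> is witnessed by
    \<open>u\<close>, that is, by \<open>u1\<close>.\<close>
  have "v1 \<cdot> Ident C K1 = v0 \<cdot> (\<delta>0 \<cdot> v1)"
    using whisker1[OF \<delta>0(4), of v1] \<delta>0 K by simp
  then obtain c1 where c1: "c1 \<in> Arr C" "Dom C c1 = K1" "Cod C c1 = P"
    "p \<cdot> c1 = Ident C K1" "q \<cdot> c1 = \<delta>0 \<cdot> v1"
    using pullback_lift[OF P, of "Ident C K1" "\<delta>0 \<cdot> v1"] \<delta>0 K KO by auto
  \<comment> \<open>\<open>c0\<close> sends \<open>(v, w)\<close> to the triple
    \<open>(v, v, w)\<close>, whose conclusion \<open>(a, b)\<close> is witnessed by
    \<open>w\<close>, that is, by \<open>w0\<close>.\<close>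
  have "v1 \<cdot> (\<delta>1 \<cdot> v0) = v0 \<cdot> Ident C K0"
    using whisker1[OF \<delta>1(5), of v0] \<delta>1 K by simp
  then obtain c0 where c0: "c0 \<in> Arr C" "Dom C c0 = K0" "Cod C c0 = P"
    "p \<cdot> c0 = \<delta>1 \<cdot> v0" "q \<cdot> c0 = Ident C K0"
    using pullback_lift[OF P, of "\<delta>1 \<cdot> v0" "Ident C K0"] \<delta>1 K KO by auto
  have "\<exists>k. k \<in> hom C K1 S \<and> h \<cdot> k = c1"
  proof (rule univ)
    show "c1 \<in> hom C K1 P" "u1 \<in> hom C K1 R" using c1 K by auto
    show "d0 \<cdot> u1 = (d0 \<cdot> (u1 \<cdot> p)) \<cdot> c1" using c1 K PD D by (simp add: assoc)
    have "w0 \<cdot> (\<delta>0 \<cdot> v1) = v1" using whisker1[OF \<delta>0(5), of v1] \<delta>0 K by simp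
    then show "d1 \<cdot> u1 = (d1 \<cdot> (w0 \<cdot> q)) \<cdot> c1" using e1 c1 K PD D by (simp add: assoc)
  qed
  then obtain s' where s': "s' \<in> Arr C" "Dom C s' = K1" "Cod C s' = S" "h \<cdot> s' = c1"
    by (auto simp: hom_def)
  have "\<exists>k. k \<in> hom C K0 S \<and> h \<cdot> k = c0"
  proof (rule univ)
    show "c0 \<in> hom C K0 P" "w0 \<in> hom C K0 R" using c0 K by auto
    have "u1 \<cdot> (\<delta>1 \<cdot> v0) = v0" using whisker1[OF \<delta>1(4), of v0] \<delta>1 K by simp
    then show "d0 \<cdot> w0 = (d0 \<cdot> (u1 \<cdot> p)) \<cdot> c0" using e0 c0 K PD D by (simp add: assoc)
    show "d1 \<cdot> w0 = (d1 \<cdot> (w0 \<cdot> q)) \<cdot> c0" using c0 K PD D by (simp add: assoc)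
  qed
  then obtain t' where t': "t' \<in> Arr C" "Dom C t' = K0" "Cod C t' = S" "h \<cdot> t' = c0"
    by (auto simp: hom_def)
  have "(p \<cdot> h) \<cdot> s' = Ident C K1" using s' c1 hD PD by (simp add: assoc)
  then have 1: "split_epi_with_section C S K1 (p \<cdot> h) s'"
    unfolding split_epi_with_section_def hom_def using s' hD PD by simp
  have "(q \<cdot> h) \<cdot> t' = Ident C K0" using t' c0 hD PD by (simp add: assoc)
  then have x: "split_epi_with_section C S K0 (q \<cdot> h) t'"
    unfolding split_epi_with_section_def hom_def using t' hD PD by simp
  have 2: "split_epi_with_section C K0 R v0 \<delta>0" and y: "split_epi_with_section C K1 R v1 \<delta>1"
    unfolding split_epi_with_section_def hom_def using \<delta>0 \<delta>1 K by simp_all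
  have 3: "v0 \<cdot> (q \<cdot> h) = v1 \<cdot> (p \<cdot> h)"
    using PD hD K by - (rule whisker; auto)
  have 4: "(q \<cdot> h) \<cdot> s' = \<delta>0 \<cdot> v1"
    using s' c1 hD PD by (simp add: assoc)
  have 5: "q \<cdot> h \<in> hom C S K0" "v1 \<in> hom C K1 R" using hD PD K by auto
  \<comment> \<open>In this square the two vertical maps \<open>p \<cdot> h\<close> and
    \<open>v0\<close> carry the chosen sections \<open>s'\<close> and \<open>\<delta>0\<close>; the
    horizontal maps \<open>q \<cdot> h\<close> and \<open>v1\<close> are regular epimorphisms
    because they are split as well. Its comparison map into \<open>P\<close> is
    \<open>h\<close>.\<close>
  have "regular_pushout C (p \<cdot> h) (q \<cdot> h) v1 v0"
    using squares[unfolded split_squares_regular_pushouts_def, rule_format,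
        of S K1 "p \<cdot> h" s' K0 R v0 \<delta>0 "q \<cdot> h" v1]
      1 2 3 4 5 split_epi_regular_epi[OF x] split_epi_regular_epi[OF y] by simp
  moreover have "h \<in> hom C (Dom C (q \<cdot> h)) P" using hD PD by auto
  ultimately have re: "regular_epi C h"
    using P unfolding regular_pushout_def by blast
  \<comment> \<open>The regular epimorphism \<open>h\<close> factors through the monomorphism
    \<open>h\<close> by the identity, so \<open>h\<close> is invertible.\<close>
  have id: "Ident C S \<in> Arr C" "Dom C (Ident C S) = Dom C h" "Cod C (Ident C S) = Dom C h"
    "h \<cdot> Ident C S = h"
    using hD obj_simps(1)[of h] by auto
  obtain k where "k \<in> Arr C" "Dom C k = Cod C h" "Cod C k = Dom C h"
    "h \<cdot> k = Ident C (Cod C h)" "k \<cdot> h = Ident C (Dom C h)"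
    by (rule regular_epi_through_monic[OF re h(1) id])
  with hD have k: "k \<in> Arr C" "Dom C k = P" "Cod C k = S" "h \<cdot> k = Ident C P" by auto
  show ?thesis
    unfolding difunctional_def
  proof (intro allI impI)
    fix T u v w
    assume "u \<in> hom C T R \<and> v \<in> hom C T R \<and> w \<in> hom C T R \<and>
      d1 \<cdot> u = d1 \<cdot> v \<and> d0 \<cdot> v = d0 \<cdot> w"
    then have U: "u \<in> Arr C" "v \<in> Arr C" "w \<in> Arr C" "Dom C u = T" "Dom C v = T" "Dom C w = T"
      "Cod C u = R" "Cod C v = R" "Cod C w = R"
      and eq: "d1 \<cdot> u = d1 \<cdot> v" "d0 \<cdot> v = d0 \<cdot> w" by (auto simp: hom_def)
    obtain a where a: "a \<in> Arr C" "Dom C a = T" "Cod C a = K1" "u1 \<cdot> a = u" "v1 \<cdot> a = v"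
      using pullback_lift[OF K1, of u v] U eq D by auto
    obtain b where b: "b \<in> Arr C" "Dom C b = T" "Cod C b = K0" "v0 \<cdot> b = v" "w0 \<cdot> b = w"
      using pullback_lift[OF K0, of v w] U eq D by auto
    obtain g where g: "g \<in> Arr C" "Dom C g = T" "Cod C g = P" "p \<cdot> g = a" "q \<cdot> g = b"
      using pullback_lift[OF P, of a b] a b K by auto
    have zD: "z \<in> Arr C" "Dom C z = S" "Cod C z = R" using z by (auto simp: hom_def)
    \<comment> \<open>The triple \<open>(u, v, w)\<close>, as the element \<open>g\<close> of
      \<open>P\<close>, lies in \<open>S\<close> by means of \<open>k \<cdot> g\<close>; its witness
      there is the required element of \<open>R\<close>.\<close>
    have hk: "h \<cdot> (k \<cdot> g) = g" using whisker1[OF k(4), of g] k g hD by simp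
    have "d0 \<cdot> (z \<cdot> (k \<cdot> g)) = (d0 \<cdot> (u1 \<cdot> p)) \<cdot> (h \<cdot> (k \<cdot> g))"
      using z(2) k g hD zD D K PD by - (rule whisker; auto)
    then have "d0 \<cdot> (z \<cdot> (k \<cdot> g)) = d0 \<cdot> u"
      using hk g a D K PD by (simp add: assoc)
    moreover have "d1 \<cdot> (z \<cdot> (k \<cdot> g)) = (d1 \<cdot> (w0 \<cdot> q)) \<cdot> (h \<cdot> (k \<cdot> g))"
      using z(3) k g hD zD D K PD by - (rule whisker; auto)
    then have "d1 \<cdot> (z \<cdot> (k \<cdot> g)) = d1 \<cdot> w"
      using hk g b D K PD by (simp add: assoc)
    moreover have "z \<cdot> (k \<cdot> g) \<in> hom C T R" using zD k g by auto
    ultimately show "\<exists>z. z \<in> hom C T R \<and> d0 \<cdot> z = d0 \<cdot> u \<and> d1 \<cdot> z = d1 \<cdot> w" by blast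
  qed
qed

end


section \<open>Images in a regular category; from difunctionality to regular pushouts\<close>

locale regular = finitely_complete_category +
  assumes regular: "regular_category C"
begin

lemma pullback_regular_epi: "is_pullback C f e P p q \<Longrightarrow> regular_epi C e \<Longrightarrow> regular_epi C p"
  using regular unfolding regular_category_def by blast

text \<open>The image is the coequalizer \<open>e\<close> of the kernel pair of \<open>h\<close>.
  That \<open>m\<close> is monic is checked on a cover: two arrows identified by \<open>m\<close>
  lift along \<open>e\<close> after pulling back, the lifts form an element of the kernel pair, and
  \<open>e\<close> identifies them.\<close>

lemma image_factorization:
  assumes h: "h \<in> Arr C"
  obtains m e where "regular_epi C e" "monic m" "Dom C e = Dom C h" "Cod C e = Dom C m"
    "Cod C m = Cod C h" "m \<cdot> e = h"
proof -
  obtain K a b where K: "is_pullback C h h K a b"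
    using pullback_exists[of h h] h by auto
  note KD = pullbackD[OF K]
  obtain e where coeq: "is_coequalizer C a b e"
    using K regular unfolding regular_category_def is_kernel_pair_def by blast
  note eD = coequalizerD[OF coeq]
  have e: "regular_epi C e" using coeq by (auto simp: regular_epi_def)
  obtain m where m: "m \<in> Arr C" "Dom C m = Cod C e" "Cod C m = Cod C h" "m \<cdot> e = h"
    using coequalizer_lift[OF coeq, of h] KD h by auto
  have "monic m"
    unfolding monic_def
  proof (intro conjI allI impI)
    show "m \<in> Arr C" by fact
    fix T u v
    assume "u \<in> hom C T (Dom C m) \<and> v \<in> hom C T (Dom C m) \<and> m \<cdot> u = m \<cdot> v"
    then have U: "u \<in> Arr C" "v \<in> Arr C" "Dom C u = T" "Dom C v = T"
      "Cod C u = Cod C e" "Cod C v = Cod C e" and eq: "m \<cdot> u = m \<cdot> v"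
      using m by (auto simp: hom_def)
    \<comment> \<open>First \<open>u\<close>, then \<open>v\<close>, is lifted along
      \<open>e\<close>. The covers \<open>e1\<close> and \<open>e2\<close> are regular epimorphisms
      by pullback stability, so they can be cancelled at the end.\<close>
    obtain T1 e1 u1 where T1: "is_pullback C u e T1 e1 u1"
      using pullback_exists[of u e] U eD by auto
    note D1 = pullbackD[OF T1]
    obtain T2 e2 v2 where T2: "is_pullback C (v \<cdot> e1) e T2 e2 v2"
      using pullback_exists[of "v \<cdot> e1" e] U eD D1 by auto
    note D2 = pullbackD[OF T2]
    have ty: "Cod C e1 = T" "Dom C e1 = T1" "Cod C u1 = Dom C h" "Dom C u1 = T1"
      "Cod C e2 = T1" "Dom C e2 = T2" "Cod C v2 = Dom C h" "Dom C v2 = T2"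
      "e1 \<in> Arr C" "u1 \<in> Arr C" "e2 \<in> Arr C" "v2 \<in> Arr C"
      using D1 D2 U eD KD by auto
    have hu: "h \<cdot> w = m \<cdot> (e \<cdot> w)" if "w \<in> Arr C" "Cod C w = Dom C h" for w
      using that m eD KD by (simp flip: assoc)
    have eu: "e \<cdot> (u1 \<cdot> e2) = u \<cdot> (e1 \<cdot> e2)"
      using D1(10) ty U eD KD by - (rule whisker; auto)
    have ev: "e \<cdot> v2 = v \<cdot> (e1 \<cdot> e2)"
      using D2(10) ty U by (simp add: assoc)
    have "m \<cdot> (u \<cdot> (e1 \<cdot> e2)) = m \<cdot> (v \<cdot> (e1 \<cdot> e2))"
      using eq ty U m by - (rule whisker; auto)
    then have "h \<cdot> (u1 \<cdot> e2) = h \<cdot> v2" using hu eu ev ty by simp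
    then obtain w where w: "w \<in> Arr C" "Cod C w = K" "a \<cdot> w = u1 \<cdot> e2" "b \<cdot> w = v2"
      using pullback_lift[OF K, of "u1 \<cdot> e2" v2] ty by auto
    have "e \<cdot> (a \<cdot> w) = e \<cdot> (b \<cdot> w)"
      using w eD KD by - (rule whisker; auto)
    then have "(u \<cdot> e1) \<cdot> e2 = (v \<cdot> e1) \<cdot> e2"
      using w eu ev ty U by (simp add: assoc)
    then have "u \<cdot> e1 = v \<cdot> e1"
      using ty U by - (rule regular_epi_cancel[OF pullback_regular_epi[OF T2 e]]; auto)
    then show "u = v"
      using ty U by - (rule regular_epi_cancel[OF pullback_regular_epi[OF T1 e]]; auto)
  qed
  then show ?thesis using that e m eD KD by auto
qed

text \<open>Write \<open>h = m \<cdot> e\<close> for the comparison, with image \<open>I \<subseteq> Y' \<times>\<^sub>Y X\<close>. A pair \<open>(y', x x')\<close> of the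
  pullback completes the three pairs \<open>(y', x s' y')\<close>, \<open>(f' x', x s' f' x')\<close>, \<open>(f' x', x x')\<close> of \<open>I\<close> to a
  rectangle, because \<open>x s' y' = s y y' = s f x x' = s y f' x' = x s' f' x'\<close>.\<close>

lemma difunctional_squares:
  assumes difun: "\<And>R d0 d1. jointly_monic R d0 d1 \<Longrightarrow> difunctional R d0 d1"
  shows split_squares_regular_pushouts
  unfolding split_squares_regular_pushouts_def
proof (intro allI impI)
  fix X' Y' X Y f' s' f s x y
  assume "split_epi_with_section C X' Y' f' s' \<and> split_epi_with_section C X Y f s \<and>
    x \<in> hom C X' X \<and> regular_epi C x \<and> y \<in> hom C Y' Y \<and> regular_epi C y \<and>
    f \<cdot> x = y \<cdot> f' \<and> x \<cdot> s' = s \<cdot> y"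
  then have ty: "f' \<in> Arr C" "s' \<in> Arr C" "f \<in> Arr C" "s \<in> Arr C" "x \<in> Arr C" "y \<in> Arr C"
      "Dom C f' = X'" "Cod C f' = Y'" "Dom C s' = Y'" "Cod C s' = X'"
      "Dom C f = X" "Cod C f = Y" "Dom C s = Y" "Cod C s = X"
      "Dom C x = X'" "Cod C x = X" "Dom C y = Y'" "Cod C y = Y"
    and fs': "f' \<cdot> s' = Ident C Y'" and x: "regular_epi C x"
    and sq: "f \<cdot> x = y \<cdot> f'" and sq': "x \<cdot> s' = s \<cdot> y"
    by (auto simp: split_epi_with_section_def hom_def)
  show "regular_pushout C f' x y f"
    unfolding regular_pushout_def
  proof (intro conjI allI impI)
    show "f \<cdot> x = y \<cdot> f'" by (rule sq)
    fix P p q h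
    assume "is_pullback C y f P p q \<and> h \<in> hom C (Dom C x) P \<and> p \<cdot> h = f' \<and> q \<cdot> h = x"
    then have P: "is_pullback C y f P p q"
      and h: "h \<in> Arr C" "Dom C h = X'" "Cod C h = P" "p \<cdot> h = f'" "q \<cdot> h = x"
      using ty by (auto simp: hom_def)
    have PD: "p \<in> Arr C" "q \<in> Arr C" "Dom C p = P" "Dom C q = P" "Cod C p = Y'" "Cod C q = X"
      and yp: "y \<cdot> p = f \<cdot> q"
      using pullbackD[OF P] ty by auto
    obtain m e where e: "regular_epi C e" and m: "monic m" and "Dom C e = Dom C h" 
      "Cod C e = Dom C m" "Cod C m = Cod C h" and me: "m \<cdot> e = h"
      by (rule image_factorization[OF h(1)])
    then obtain I where I: "e \<in> Arr C" "m \<in> Arr C" "Dom C e = X'" "Cod C e = I" "Dom C m = I"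
      "Cod C m = P"
      using h regular_epi_arr by (auto simp: monic_def)
    have jm: "jointly_monic I (p \<cdot> m) (q \<cdot> m)"
      unfolding jointly_monic_def
    proof (intro conjI allI impI)
      fix T u v
      assume "u \<in> hom C T I \<and> v \<in> hom C T I \<and> (p \<cdot> m) \<cdot> u = (p \<cdot> m) \<cdot> v \<and> (q \<cdot> m) \<cdot> u = (q \<cdot> m) \<cdot> v"
      then have U: "u \<in> Arr C" "v \<in> Arr C" "Dom C u = T" "Dom C v = T" "Cod C u = I" "Cod C v = I"
        and "(p \<cdot> m) \<cdot> u = (p \<cdot> m) \<cdot> v" "(q \<cdot> m) \<cdot> u = (q \<cdot> m) \<cdot> v" by (auto simp: hom_def)
      then have "p \<cdot> (m \<cdot> u) = p \<cdot> (m \<cdot> v)" "q \<cdot> (m \<cdot> u) = q \<cdot> (m \<cdot> v)"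
        using I PD by (simp_all add: assoc)
      then have "m \<cdot> u = m \<cdot> v"
        using U I by - (rule jointly_monicD[OF pullback_jointly_monic[OF P]]; auto)
      then show "u = v" using U I by - (rule monicD[OF m]; auto)
    qed (use I PD in auto)
    \<comment> \<open>As \<open>x\<close> is a regular epimorphism, so is its pullback
      \<open>t\<close> along \<open>q\<close>. On the cover \<open>T\<close> of \<open>P\<close> the
      second coordinate has the form \<open>x \<cdot> x'\<close>, and it suffices to factor
      \<open>t\<close> through \<open>m\<close>.\<close>
    obtain T t x' where T: "is_pullback C q x T t x'"
      using pullback_exists[of q x] PD ty by auto
    have t: "regular_epi C t" by (rule pullback_regular_epi[OF T x])
    have TD: "t \<in> Arr C" "x' \<in> Arr C" "Dom C t = T" "Dom C x' = T" "Cod C t = P" "Cod C x' = X'"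
      and qt: "q \<cdot> t = x \<cdot> x'"
      using pullbackD[OF T] PD ty by auto
    have em: "(p \<cdot> m) \<cdot> (e \<cdot> w) = f' \<cdot> w" "(q \<cdot> m) \<cdot> (e \<cdot> w) = x \<cdot> w"
      if w: "w \<in> Arr C" "Cod C w = X'" for w
    proof -
      have "m \<cdot> (e \<cdot> w) = h \<cdot> w" using whisker1[OF me, of w] w I by simp
      then show "(p \<cdot> m) \<cdot> (e \<cdot> w) = f' \<cdot> w" "(q \<cdot> m) \<cdot> (e \<cdot> w) = x \<cdot> w"
        using whisker1[OF h(4), of w] whisker1[OF h(5), of w] w I PD h by (simp_all add: assoc)
    qed
    have f's': "f' \<cdot> (s' \<cdot> w) = w" if "w \<in> Arr C" "Cod C w = Y'" for w
      using whisker1[OF fs', of w] that ty by simp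
    have xs': "x \<cdot> (s' \<cdot> w) = s \<cdot> (y \<cdot> w)" if "w \<in> Arr C" "Cod C w = Y'" for w
      using whisker[OF sq', of w] that ty by simp
    have "y \<cdot> (p \<cdot> t) = f \<cdot> (q \<cdot> t)" using whisker[OF yp, of t] TD PD ty by simp
    also have "\<dots> = y \<cdot> (f' \<cdot> x')" using whisker[OF sq, of x'] qt TD ty by simp
    finally have ypt: "y \<cdot> (p \<cdot> t) = y \<cdot> (f' \<cdot> x')" .
    \<comment> \<open>The three pairs of \<open>I\<close>, with \<open>p \<cdot> t\<close> for the
      generic \<open>y'\<close>; each is the image under \<open>e\<close> of an element of
      \<open>X'\<close>.\<close>
    let ?u = "e \<cdot> (s' \<cdot> (p \<cdot> t))" and ?v = "e \<cdot> (s' \<cdot> (f' \<cdot> x'))" and ?w = "e \<cdot> x'"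
    have "?u \<in> hom C T I" "?v \<in> hom C T I" "?w \<in> hom C T I" using I TD PD ty by auto
    moreover have "(q \<cdot> m) \<cdot> ?u = (q \<cdot> m) \<cdot> ?v" using em xs' ypt TD PD ty by simp
    moreover have "(p \<cdot> m) \<cdot> ?v = (p \<cdot> m) \<cdot> ?w" using em f's' TD ty by simp
    ultimately obtain g where g: "g \<in> hom C T I"
      "(p \<cdot> m) \<cdot> g = (p \<cdot> m) \<cdot> ?u" "(q \<cdot> m) \<cdot> g = (q \<cdot> m) \<cdot> ?w"
      using difun[OF jm] unfolding difunctional_def by blast
    have gD: "g \<in> Arr C" "Dom C g = T" "Cod C g = I" using g by (auto simp: hom_def)
    have "(p \<cdot> m) \<cdot> g = p \<cdot> t" using g(2) em f's' TD PD ty by simp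
    moreover have "(q \<cdot> m) \<cdot> g = q \<cdot> t" using g(3) em qt TD by simp
    ultimately have "p \<cdot> (m \<cdot> g) = p \<cdot> t" "q \<cdot> (m \<cdot> g) = q \<cdot> t"
      using gD I PD by (simp_all add: assoc)
    \<comment> \<open>The rectangle is completed by the generic element of \<open>P\<close> over
      \<open>T\<close>, so \<open>t\<close> factors through \<open>m\<close>. Hence \<open>m\<close>
      is invertible, and \<open>h\<close> is \<open>e\<close> followed by an isomorphism.\<close>
    then have mg: "m \<cdot> g = t"
      using gD I TD by - (rule jointly_monicD[OF pullback_jointly_monic[OF P]]; auto)
    have "Dom C g = Dom C t" "Cod C g = Dom C m" using gD TD I by auto
    from regular_epi_through_monic[OF t m gD(1) this mg]
    obtain k where "k \<in> Arr C" "Dom C k = Cod C m" "Cod C k = Dom C m"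
      "m \<cdot> k = Ident C (Cod C m)" "k \<cdot> m = Ident C (Dom C m)" .
    then have "regular_epi C (m \<cdot> e)"
      using I by - (rule regular_epi_comp_iso[OF e, of m k]; simp)
    then show "regular_epi C h" using me by simp
  qed
qed

theorem maltsev_iff: "maltsev_category C \<longleftrightarrow> split_squares_regular_pushouts"
  using maltsev_difunctional difunctional_maltsev squares_difunctional difunctional_squares by blast

end

theorem corollary53:
  fixes E :: "('o, 'm) category"
  assumes "regular_category E"
  shows "maltsev_category E \<longleftrightarrow>
    (\<forall>X' Y' X Y f' s' f s x y.
       split_epi_with_section E X' Y' f' s' \<and>
       split_epi_with_section E X Y f s \<and>
       x \<in> hom E X' X \<and> regular_epi E x \<and>
       y \<in> hom E Y' Y \<and> regular_epi E y \<and>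
       f \<cdot>\<^bsub>E\<^esub> x = y \<cdot>\<^bsub>E\<^esub> f' \<and>
       x \<cdot>\<^bsub>E\<^esub> s' = s \<cdot>\<^bsub>E\<^esub> y \<longrightarrow>
       regular_pushout E f' x y f)"
proof -
  interpret category E using assms by (simp add: regular_category_def)
  interpret regular E
    by unfold_locales (use assms in \<open>simp_all add: regular_category_def\<close>)
  show ?thesis using maltsev_iff unfolding split_squares_regular_pushouts_def .
qed

end
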